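(* Let $(w_k),(w'_k),(y_k),(x_k)$ be sequences generated by the IneIREG-Bregman algorithm (described in the context), with parameters $\alpha_k\ge 0$, $\lambda_k>0$, $\eta_k>0$, and let $\delta_k:=\frac{\alpha_k(1+\alpha_k)}{2\mu}\|\nabla\omega(x_k)-\nabla\omega(x_{k-1})\|^2$ for $k\ge 0$. Suppose that: (i) $\eta_k=\dfrac{\eta_0}{(k+1)^b}$ for all $k\ge0$, where $0<\eta_0\le1$ and $0<b<1$; (ii) $\alpha_0\in[0,1]$ and $\alpha_k\eta_k^{-1}\ge\alpha_{k+1}\eta_{k+1}^{-1}$ for all $k\ge0$; (iii) $\lambda_k\in[\underline\lambda,\overline\lambda]$ for all $k\ge0$, where $0<\underline\lambda\le\overline\lambda\le\mu/L_0$ and $L_0:=L_F+\eta_0L_H$; (iv) $s:=\sum_{k=0}^\infty\delta_k\eta_k^{-1}<+\infty$. For $k\ge1$ let $\overline y_k:=\frac1{\Lambda_k}\sum_{j=0}^{k-1}\lambda_jy_j$ with $\Lambda_k:=\sum_{j=0}^{k-1}\lambda_j$. Then the following hold. (a) (Feasibility) For all $k\ge1$, $$0\le\operatorname{Gap}(\overline y_k,F,X)\le\frac1k\left(\frac{\Omega_X^2}{\underline\lambda}\right)+\frac1k\left(\frac{s}{\underline\lambda}\right)+\frac1{k^b}\left(\frac{\eta_0\overline\lambda C_HD_X}{(1-b)\underline\lambda}\right).$$ (b) (Optimality) For all $k\ge1$, $$-B_H\operatorname{dist}(\overline y_k,Q)\le\operatorname{Gap}(\overline y_k,H,Q)\le\frac1{k^{1-b}}\left(\frac{\Omega_X^2}{2^{-b}\underline\lambda\,\eta_0}\right)+\frac1k\left(\frac{s}{\underline\lambda}\right).$$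 Moreover, if $Q$ is $\sigma$-weakly sharp of order $\mathcal M\ge1$, then for all $k\ge1$, $$\operatorname{Gap}(\overline y_k,H,Q)\ge-\frac{B_H}{\sigma^{1/\mathcal M}}\left(\frac1k\left(\frac{\Omega_X^2}{\underline\lambda}\right)+\frac1k\left(\frac{s}{\underline\lambda}\right)+\frac1{k^b}\left(\frac{\eta_0\overline\lambda C_HD_X}{(1-b)\underline\lambda}\right)\right)^{1/\mathcal M}.$$
   Context: $\mathbb R^n$ carries its Euclidean inner product $\langle\cdot,\cdot\rangle$ and norm $\|\cdot\|$. Distance-generating function: $\omega:\mathbb R^n\to\mathbb R\cup\{+\infty\}$ is $\mu$-strongly convex ($\mu>0$) with respect to $\|\cdot\|$ and of Legendre type, i.e. proper, closed, strictly convex and essentially smooth (differentiable on $\operatorname{int}(\operatorname{dom}\omega)\ne\emptyset$, with $\|\nabla\omega(x^k)\|\to+\infty$ whenever $(x^k)\subset\operatorname{int}(\operatorname{dom}\omega)$ converges to a boundary point of $\operatorname{dom}\omega$). $\omega^*$ is its convex conjugate. The Bregman distance is $D_\omega(x,y):=\omega(x)-\omega(y)-\langle\nabla\omega(y),x-y\rangle$ for $x\in\operatorname{dom}\omega$, $y\in\operatorname{int}(\operatorname{dom}\omega)$. Problem data: $F:\operatorname{dom}F\subseteq\mathbb R^n\to\mathbb R^n$ and $H:\operatorname{dom}H\subseteq\mathbb R^n\to\mathbb R^n$ are monotone and Lipschitz continuous with constants $L_F>0$ and $L_H>0$. $X$ and $\Omega$ are nonempty closed convex subsets of $\mathbb R^n$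 with $X\subset\Omega\subseteq\operatorname{dom}\omega\subseteq\operatorname{dom}F\cap\operatorname{dom}H$ (inclusions not necessarily strict). $Q:=\{x\in X:\langle F(x),y-x\rangle\ge0\ \ \forall y\in X\}$ is nonempty. Put $C_H:=\sup_{x\in X}\|H(x)\|<+\infty$ and $B_H:=\sup_{x\in Q}\|H(x)\|<+\infty$. Diameters: $D_X:=\sup_{u,v\in X}\|u-v\|$ and $\Omega_X^2:=\sup\{D_\omega(u,v):u\in X,\ v\in X\cap\operatorname{int}(\operatorname{dom}\omega)\}$, both assumed finite. Dual gap functions: $\operatorname{Gap}(z,H,Q):=\sup_{x\in Q}\langle H(x),z-x\rangle$ and $\operatorname{Gap}(z,F,X):=\sup_{x\in X}\langle F(x),z-x\rangle$. Also $\operatorname{dist}(z,Q):=\inf_{q\in Q}\|z-q\|$. $Q$ is $\sigma$-weakly sharp of order $\mathcal M\ge1$ if $\sigma>0$ and $\langle F(x),y-x\rangle\ge\sigma\,(\operatorname{dist}(y,Q))^{\mathcal M}$ for all $x\in Q$, $y\in X$. IneIREG-Bregman algorithm: start with $x_0=x_{-1}\in X\cap\operatorname{int}(\operatorname{dom}\omega)$. For $k=0,1,\dots$, with chosen $\alpha_k\ge0$, $\lambda_k>0$, $\eta_k>0$, set $w_k:=\nabla\omega^*\big((1+\alpha_k)\nabla\omega(x_k)-\alpha_k\nabla\omega(x_{k-1})\big)$, $w'_k:=\operatorname{argmin}_{u\in\Omega}D_\omega(u,w_k)$, $y_k:=\operatorname{argmin}_{u\in X}\{\lambda_k\langle F(w'_k)+\eta_kH(w'_k),u\rangle+D_\omega(u,w_k)\}$,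 $x_{k+1}:=\operatorname{argmin}_{u\in X}\{\lambda_k\langle F(y_k)+\eta_kH(y_k),u\rangle+D_\omega(u,w_k)\}$. (These are well defined, all points lying in $\operatorname{int}(\operatorname{dom}\omega)$.) *)

theory Defs
  imports "HOL-Analysis.Analysis"
begin

definition edom :: "('a \<Rightarrow> ereal) \<Rightarrow> 'a set" where
  "edom f = {x. f x < \<infinity>}"

definition proper_fun :: "('a \<Rightarrow> ereal) \<Rightarrow> bool" where
  "proper_fun f \<longleftrightarrow> (\<forall>x. f x \<noteq> -\<infinity>) \<and> edom f \<noteq> {}"

(* "Closed" in the sense of convex analysis: the epigraph is a closed set. *)
definition closed_fun :: "('a::topological_space \<Rightarrow> ereal) \<Rightarrow> bool" where
  "closed_fun f \<longleftrightarrow> closed {(x, r :: real). f x \<le> ereal r}"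

definition strictly_convex_fun :: "('a::real_vector \<Rightarrow> ereal) \<Rightarrow> bool" where
  "strictly_convex_fun f \<longleftrightarrow>
     (\<forall>x\<in>edom f. \<forall>y\<in>edom f. \<forall>t\<in>{0<..<1}. x \<noteq> y \<longrightarrow>
        f ((1 - t) *\<^sub>R x + t *\<^sub>R y) < ereal (1 - t) * f x + ereal t * f y)"

definition strongly_convex_fun :: "real \<Rightarrow> ('a::real_normed_vector \<Rightarrow> ereal) \<Rightarrow> bool" where
  "strongly_convex_fun \<mu> f \<longleftrightarrow>
     (\<forall>x\<in>edom f. \<forall>y\<in>edom f. \<forall>t\<in>{0<..<1}.
        f ((1 - t) *\<^sub>R x + t *\<^sub>R y) + ereal (\<mu> / 2 * t * (1 - t) * (norm (x - y))\<^sup>2)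
          \<le> ereal (1 - t) * f x + ereal t * f y)"

(* Gradient of the real-valued part of f; only meaningful in the interior of the domain,
   where f is finite (for proper f) in a whole neighbourhood. *)
definition grad :: "('a::real_inner \<Rightarrow> ereal) \<Rightarrow> 'a \<Rightarrow> 'a" where
  "grad f x = (THE D. GDERIV (\<lambda>z. real_of_ereal (f z)) x :> D)"

definition essentially_smooth :: "('a::real_inner \<Rightarrow> ereal) \<Rightarrow> bool" where
  "essentially_smooth f \<longleftrightarrow>
     interior (edom f) \<noteq> {} \<and>
     (\<forall>x\<in>interior (edom f). (\<lambda>z. real_of_ereal (f z)) differentiable (at x)) \<and>
     (\<forall>(z :: nat \<Rightarrow> 'a) l. (\<forall>k. z k \<in> interior (edom f)) \<longrightarrow> l \<in> frontier (edom f) \<longrightarrow>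
        z \<longlonglongrightarrow> l \<longrightarrow> filterlim (\<lambda>k. norm (grad f (z k))) at_top sequentially)"

definition legendre_type :: "('a::real_inner \<Rightarrow> ereal) \<Rightarrow> bool" where
  "legendre_type f \<longleftrightarrow>
     proper_fun f \<and> closed_fun f \<and> strictly_convex_fun f \<and> essentially_smooth f"

definition convex_conjugate :: "('a::real_inner \<Rightarrow> ereal) \<Rightarrow> 'a \<Rightarrow> ereal" where
  "convex_conjugate f p = (SUP x. ereal (p \<bullet> x) - f x)"

(* Used for x in the domain of \<omega> and y in its interior, where both values are finite. *)
definition bregman :: "('a::real_inner \<Rightarrow> ereal) \<Rightarrow> 'a \<Rightarrow> 'a \<Rightarrow> real" where
  "bregman \<omega> x y = real_of_ereal (\<omega> x) - real_of_ereal (\<omega> y) - grad \<omega> y \<bullet> (x - y)"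

definition monotone_operator_on :: "'a::real_inner set \<Rightarrow> ('a \<Rightarrow> 'a) \<Rightarrow> bool" where
  "monotone_operator_on S F \<longleftrightarrow> (\<forall>x\<in>S. \<forall>y\<in>S. (F x - F y) \<bullet> (x - y) \<ge> 0)"

definition vi_solutions :: "('a::real_inner \<Rightarrow> 'a) \<Rightarrow> 'a set \<Rightarrow> 'a set" where
  "vi_solutions F X = {x \<in> X. \<forall>y\<in>X. F x \<bullet> (y - x) \<ge> 0}"

(* The dual gap is extended-real-valued, so that the supremum is meaningful without
   a boundedness side condition. *)
definition dual_gap :: "'a::real_inner \<Rightarrow> ('a \<Rightarrow> 'a) \<Rightarrow> 'a set \<Rightarrow> ereal" where
  "dual_gap z F X = (SUP x\<in>X. ereal (F x \<bullet> (z - x)))"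

definition weakly_sharp ::
  "('a::euclidean_space \<Rightarrow> 'a) \<Rightarrow> 'a set \<Rightarrow> real \<Rightarrow> real \<Rightarrow> bool" where
  "weakly_sharp F X \<sigma> M \<longleftrightarrow> \<sigma> > 0 \<and> M \<ge> 1 \<and>
     (\<forall>x\<in>vi_solutions F X. \<forall>y\<in>X. F x \<bullet> (y - x) \<ge> \<sigma> * infdist y (vi_solutions F X) powr M)"

(* The iterates x are indexed by integers because the scheme starts from x 0 and x (-1);
   values of x below index -1 play no role. *)
definition IneIREG_Bregman ::
  "('a::euclidean_space \<Rightarrow> ereal) \<Rightarrow> 'a set \<Rightarrow> 'a set \<Rightarrow> ('a \<Rightarrow> 'a) \<Rightarrow> ('a \<Rightarrow> 'a) \<Rightarrow>
   (nat \<Rightarrow> real) \<Rightarrow> (nat \<Rightarrow> real) \<Rightarrow> (nat \<Rightarrow> real) \<Rightarrow>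
   (nat \<Rightarrow> 'a) \<Rightarrow> (nat \<Rightarrow> 'a) \<Rightarrow> (nat \<Rightarrow> 'a) \<Rightarrow> (int \<Rightarrow> 'a) \<Rightarrow> bool" where
  "IneIREG_Bregman \<omega> X \<Omega> F H \<alpha> lam \<eta> w w' y x \<longleftrightarrow>
     x 0 = x (-1) \<and> x 0 \<in> X \<inter> interior (edom \<omega>) \<and>
     (\<forall>k. w k = grad (convex_conjugate \<omega>)
                  ((1 + \<alpha> k) *\<^sub>R grad \<omega> (x (int k)) - \<alpha> k *\<^sub>R grad \<omega> (x (int k - 1)))) \<and>
     (\<forall>k. is_arg_min (\<lambda>u. bregman \<omega> u (w k)) (\<lambda>u. u \<in> \<Omega>) (w' k)) \<and>
     (\<forall>k. is_arg_min
            (\<lambda>u. lam k * ((F (w' k) + \<eta> k *\<^sub>R H (w' k)) \<bullet> u) + bregman \<omega> u (w k))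
            (\<lambda>u. u \<in> X) (y k)) \<and>
     (\<forall>k. is_arg_min
            (\<lambda>u. lam k * ((F (y k) + \<eta> k *\<^sub>R H (y k)) \<bullet> u) + bregman \<omega> u (w k))
            (\<lambda>u. u \<in> X) (x (int k + 1)))"

end

theory Submission
  imports Defs
begin

text \<open>
  The proof is an energy argument with the Bregman distance to a comparison point
  \<open>u \<in> X\<close> as energy, \<open>\<phi>\<^sub>k = D\<^sub>\<omega> u (x\<^sub>k)\<close>. Each iteration is an extragradient step
  for the operator \<open>G\<^sub>k = F + \<eta>\<^sub>k H\<close> that starts from the inertial point \<open>w\<^sub>k\<close>. The step size
  restriction lets the strong convexity of \<open>\<omega>\<close> absorb the error made by evaluating \<open>G\<^sub>k\<close> at
  \<open>w'\<^sub>k\<close> rather than at \<open>y\<^sub>k\<close>, and what remains is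
  \<open>\<lambda>\<^sub>k \<langle>G\<^sub>k y\<^sub>k, y\<^sub>k - u\<rangle> \<le> D\<^sub>\<omega> u (w\<^sub>k) - \<phi>\<^sub>k\<^sub>+\<^sub>1\<close> (lemma \<open>extragradient_step\<close>). Extrapolation takes place
  among gradients, where it is affine, so \<open>D\<^sub>\<omega> u (w\<^sub>k)\<close> differs from
  \<open>\<phi>\<^sub>k + \<alpha>\<^sub>k (\<phi>\<^sub>k - \<phi>\<^sub>k\<^sub>-\<^sub>1)\<close> by a quantity independent of \<open>u\<close>, and strong convexity bounds this
  quantity by \<open>\<delta>\<^sub>k\<close> (lemma \<open>inertial_bregman_bound\<close>).

  These inequalities are summed with nondecreasing weights \<open>c\<^sub>j\<close> for which \<open>c\<^sub>j \<alpha>\<^sub>j\<close> is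
  nonincreasing; by Abel summation the energy and inertia terms together cost no more than the last
  weight times the Bregman diameter of \<open>X\<close> (lemma \<open>inertial_abel_bound\<close>). The weights
  \<open>c\<^sub>j = 1\<close>, with the monotonicity of \<open>F\<close> and a crude bound on the \<open>H\<close> terms, give feasibility.
  The weights \<open>c\<^sub>j = 1 / \<eta>\<^sub>j\<close>, with \<open>u\<close> a solution so that the \<open>F\<close> terms are nonnegative, give
  optimality. Dividing by \<open>\<Lambda>\<^sub>k \<ge> k \<lambda>\<close>, where \<open>\<lambda>\<close> is the lower bound of the step sizes, gives the
  rates.

  All of this needs the iterates to lie in the interior of the domain of \<open>\<omega>\<close>, where gradients
  exist, and \<open>w\<^sub>k\<close> to satisfy \<open>\<nabla>\<omega>(w\<^sub>k) = (1 + \<alpha>\<^sub>k) \<nabla>\<omega>(x\<^sub>k) - \<alpha>\<^sub>k \<nabla>\<omega>(x\<^sub>k\<^sub>-\<^sub>1)\<close>. Both follow from essential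
  smoothness: a minimiser of \<open>\<omega>\<close> minus a linear function over a convex set that meets the interior is
  itself interior (lemma \<open>minimizer_interior\<close>). Over the whole domain such a minimiser exists by strong
  convexity, which makes \<open>\<nabla>\<omega>\<close> surjective with inverse \<open>\<nabla>\<omega>\<^sup>*\<close> (lemmas \<open>grad_surjective\<close> and
  \<open>grad_conjugate\<close>).

  The lower bounds are elementary: the average lies in \<open>X\<close>, so its gap over \<open>X\<close> is nonnegative;
  Cauchy-Schwarz bounds the gap over \<open>Q\<close> by the distance to \<open>Q\<close>; and weak sharpness bounds
  that distance by a power of the feasibility gap.
\<close>

section \<open>Gradients and strongly convex Legendre functions\<close>

lemma GDERIV_unique:
  assumes "GDERIV f x :> D" "GDERIV f x :> E"
  shows "D = E"
proof -
  have "(\<lambda>h. h \<bullet> D) = (\<lambda>h. h \<bullet> E)"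
    using assms unfolding gderiv_def by (rule has_derivative_unique)
  then show ?thesis
    by (metis vector_eq_ldot)
qed

lemma grad_eqI:
  assumes "GDERIV (\<lambda>z. real_of_ereal (f z)) x :> D"
  shows "grad f x = D"
  unfolding grad_def using assms by (blast intro: the_equality GDERIV_unique)

locale legendre_kernel =
  fixes \<omega> :: "'a::euclidean_space \<Rightarrow> ereal" and \<mu> :: real
  assumes mu_pos: "\<mu> > 0"
    and strongly_convex: "strongly_convex_fun \<mu> \<omega>"
    and legendre: "legendre_type \<omega>"
begin

abbreviation \<omega>\<^sub>r :: "'a \<Rightarrow> real" where
  "\<omega>\<^sub>r z \<equiv> real_of_ereal (\<omega> z)"

abbreviation D\<^sub>\<omega> :: "'a \<Rightarrow> 'a \<Rightarrow> real" where
  "D\<^sub>\<omega> \<equiv> bregman \<omega>"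

text \<open>
  The equation is oriented from the real value to the extended one: the other direction would loop as
  a rewrite rule.
\<close>

lemma kernel_real: "x \<in> edom \<omega> \<Longrightarrow> ereal (\<omega>\<^sub>r x) = \<omega> x"
  using legendre unfolding legendre_type_def proper_fun_def edom_def
  by (cases "\<omega> x") auto

lemma interior_edom: "x \<in> interior (edom \<omega>) \<Longrightarrow> x \<in> edom \<omega>"
  using interior_subset by blast

lemma strong_convexity_real:
  assumes "x \<in> edom \<omega>" "y \<in> edom \<omega>" "0 < t" "t < 1"
  shows "(1 - t) *\<^sub>R x + t *\<^sub>R y \<in> edom \<omega>"
    and "\<omega>\<^sub>r ((1 - t) *\<^sub>R x + t *\<^sub>R y) + \<mu> / 2 * t * (1 - t) * (norm (x - y))\<^sup>2
      \<le> (1 - t) * \<omega>\<^sub>r x + t * \<omega>\<^sub>r y"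
proof -
  let ?z = "(1 - t) *\<^sub>R x + t *\<^sub>R y"
  have le: "\<omega> ?z + ereal (\<mu> / 2 * t * (1 - t) * (norm (x - y))\<^sup>2)
      \<le> ereal ((1 - t) * \<omega>\<^sub>r x + t * \<omega>\<^sub>r y)"
  proof -
    have "\<omega> ?z + ereal (\<mu> / 2 * t * (1 - t) * (norm (x - y))\<^sup>2)
      \<le> ereal (1 - t) * \<omega> x + ereal t * \<omega> y"
      using strongly_convex assms unfolding strongly_convex_fun_def by simp
    then show ?thesis
      by (subst (asm) kernel_real[OF assms(1), symmetric], subst (asm) kernel_real[OF assms(2), symmetric]) simp
  qed
  then show "?z \<in> edom \<omega>"
    unfolding edom_def by (cases "\<omega> ?z") auto
  from le kernel_real[OF this]
  show "\<omega>\<^sub>r ?z + \<mu> / 2 * t * (1 - t) * (norm (x - y))\<^sup>2 \<le> (1 - t) * \<omega>\<^sub>r x + t * \<omega>\<^sub>r y"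
    by (metis ereal_less_eq(3) plus_ereal.simps(1))
qed

lemma convex_edom: "convex (edom \<omega>)"
  unfolding convex_alt
proof (intro ballI allI impI)
  fix x y and t :: real
  assume "x \<in> edom \<omega>" "y \<in> edom \<omega>" "0 \<le> t \<and> t \<le> 1"
  then show "(1 - t) *\<^sub>R x + t *\<^sub>R y \<in> edom \<omega>"
    using strong_convexity_real(1)[of x y t] by (cases "t = 0 \<or> t = 1") auto
qed

lemma GDERIV_kernel:
  assumes "y \<in> interior (edom \<omega>)"
  shows "GDERIV \<omega>\<^sub>r y :> grad \<omega> y"
proof -
  obtain f' where f': "(\<omega>\<^sub>r has_derivative f') (at y)"
    using legendre assms
    unfolding legendre_type_def essentially_smooth_def differentiable_def by blast
  then have "linear f'"
    by (rule has_derivative_linear)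
  then have "f' = (\<lambda>h. h \<bullet> adjoint f' 1)"
    by (simp add: adjoint_works)
  with f' have "GDERIV \<omega>\<^sub>r y :> adjoint f' 1"
    unfolding gderiv_def by metis
  then show ?thesis
    using grad_eqI by metis
qed

lemma kernel_difference_quotient:
  assumes "y \<in> interior (edom \<omega>)"
  shows "((\<lambda>t. (\<omega>\<^sub>r (y + t *\<^sub>R d) - \<omega>\<^sub>r y) / t) \<longlongrightarrow> grad \<omega> y \<bullet> d) (at_right 0)"
proof -
  have "((\<lambda>t. y + t *\<^sub>R d) has_derivative (\<lambda>t. t *\<^sub>R d)) (at 0)"
    by (auto intro!: derivative_eq_intros)
  moreover have "(\<omega>\<^sub>r has_derivative (\<lambda>h. h \<bullet> grad \<omega> y)) (at (y + 0 *\<^sub>R d))"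
    using GDERIV_kernel[OF assms] by (simp add: gderiv_def)
  ultimately have "((\<lambda>t. \<omega>\<^sub>r (y + t *\<^sub>R d)) has_derivative (\<lambda>t. (t *\<^sub>R d) \<bullet> grad \<omega> y)) (at 0)"
    by (rule has_derivative_compose)
  then have "((\<lambda>t. \<omega>\<^sub>r (y + t *\<^sub>R d)) has_field_derivative (grad \<omega> y \<bullet> d)) (at 0)"
    by (simp add: has_field_derivative_def inner_commute mult_commute_abs)
  then have "((\<lambda>t. (\<omega>\<^sub>r (y + t *\<^sub>R d) - \<omega>\<^sub>r y) / t) \<longlongrightarrow> grad \<omega> y \<bullet> d) (at 0)"
    by (simp add: has_field_derivative_iff)
  then show ?thesis
    by (rule filterlim_mono) (auto simp: at_le)
qed

text \<open>
  Strong convexity along the segment from \<open>y\<close> to \<open>x\<close> bounds the difference quotient at \<open>y\<close>; its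
  limit at \<open>y\<close> is the tangent inequality with a quadratic gain.
\<close>

lemma bregman_lower:
  assumes x: "x \<in> edom \<omega>" and y: "y \<in> interior (edom \<omega>)"
  shows "\<mu> / 2 * (norm (x - y))\<^sup>2 \<le> D\<^sub>\<omega> x y"
proof -
  let ?q = "\<lambda>t. (\<omega>\<^sub>r (y + t *\<^sub>R (x - y)) - \<omega>\<^sub>r y) / t + \<mu> / 2 * (1 - t) * (norm (x - y))\<^sup>2"
  have lim: "(?q \<longlongrightarrow> grad \<omega> y \<bullet> (x - y) + \<mu> / 2 * (1 - 0) * (norm (x - y))\<^sup>2) (at_right 0)"
    by (intro tendsto_intros kernel_difference_quotient y)
  have "?q t \<le> \<omega>\<^sub>r x - \<omega>\<^sub>r y" if t: "0 < t" "t < 1" for t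
  proof -
    have eq: "(1 - t) *\<^sub>R y + t *\<^sub>R x = y + t *\<^sub>R (x - y)"
      by (simp add: algebra_simps)
    have "\<omega>\<^sub>r (y + t *\<^sub>R (x - y)) + \<mu> / 2 * t * (1 - t) * (norm (x - y))\<^sup>2
        \<le> (1 - t) * \<omega>\<^sub>r y + t * \<omega>\<^sub>r x"
      using strong_convexity_real(2)[OF interior_edom[OF y] x t]
      by (simp only: eq norm_minus_commute[of y x])
    moreover have "t * ?q t = \<omega>\<^sub>r (y + t *\<^sub>R (x - y)) - \<omega>\<^sub>r y
        + \<mu> / 2 * t * (1 - t) * (norm (x - y))\<^sup>2"
      using t by (simp only: distrib_left) simp
    ultimately have "t * ?q t \<le> t * (\<omega>\<^sub>r x - \<omega>\<^sub>r y)"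
      by (simp add: algebra_simps)
    then show ?thesis
      using t by (simp only: mult_le_cancel_left_pos)
  qed
  then have "eventually (\<lambda>t. ?q t \<le> \<omega>\<^sub>r x - \<omega>\<^sub>r y) (at_right 0)"
    unfolding eventually_at_right_field by (intro exI[of _ 1]) auto
  from tendsto_upperbound[OF lim this] show ?thesis
    unfolding bregman_def by simp
qed

lemma bregman_nonneg:
  assumes "x \<in> edom \<omega>" "y \<in> interior (edom \<omega>)"
  shows "0 \<le> D\<^sub>\<omega> x y"
proof -
  have "0 \<le> \<mu> / 2 * (norm (x - y))\<^sup>2"
    using mu_pos by simp
  also have "\<dots> \<le> D\<^sub>\<omega> x y"
    by (rule bregman_lower[OF assms])
  finally show ?thesis .
qed

lemma kernel_above_tangent:
  assumes "x \<in> edom \<omega>" "y \<in> interior (edom \<omega>)"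
  shows "\<omega>\<^sub>r y + grad \<omega> y \<bullet> (x - y) \<le> \<omega>\<^sub>r x"
  using bregman_nonneg[OF assms] by (simp add: bregman_def)

text \<open>
  The values of \<open>\<omega>\<close> cancel and only gradients remain, which is why first-order optimality of a
  proximal step turns into an inequality between Bregman distances.
\<close>

lemma three_point:
  "D\<^sub>\<omega> u w = D\<^sub>\<omega> u v + D\<^sub>\<omega> v w + (grad \<omega> v - grad \<omega> w) \<bullet> (u - v)"
  by (simp add: bregman_def algebra_simps)

text \<open>
  The two Bregman distances between \<open>x\<close> and \<open>y\<close> add up to
  \<open>\<langle>\<nabla>\<omega>(x) - \<nabla>\<omega>(y), x - y\<rangle>\<close>. Subtracting the quadratic lower bound of one of them and completing
  the square bounds the other by the distance of the gradients.
\<close>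

lemma bregman_upper:
  assumes "x \<in> interior (edom \<omega>)" "y \<in> interior (edom \<omega>)"
  shows "D\<^sub>\<omega> x y \<le> (norm (grad \<omega> x - grad \<omega> y))\<^sup>2 / (2 * \<mu>)"
proof -
  let ?g = "norm (grad \<omega> x - grad \<omega> y)" and ?d = "norm (x - y)"
  have "D\<^sub>\<omega> x y + D\<^sub>\<omega> y x = (grad \<omega> x - grad \<omega> y) \<bullet> (x - y)"
    by (simp add: bregman_def algebra_simps)
  also have "\<dots> \<le> ?g * ?d"
    by (rule norm_cauchy_schwarz)
  finally have "D\<^sub>\<omega> x y \<le> ?g * ?d - \<mu> / 2 * ?d\<^sup>2"
    using bregman_lower[OF interior_edom[OF assms(2)] assms(1)]
    by (simp add: norm_minus_commute)
  also have "\<dots> = (?g\<^sup>2 - (?g - \<mu> * ?d)\<^sup>2) / (2 * \<mu>)"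
    using mu_pos by (simp add: field_simps power2_eq_square)
  also have "\<dots> \<le> ?g\<^sup>2 / (2 * \<mu>)"
    using mu_pos by (intro divide_right_mono) auto
  finally show ?thesis .
qed

text \<open>
  The idea is Rockafellar's. Suppose that the minimiser \<open>u\<close> is a boundary point, and approach it from the
  interior point \<open>z\<close> along the segment. The gradients \<open>g\<close> at the approaching points \<open>v\<close> blow up
  in norm. The tangent inequality at \<open>v\<close>, tested at the point of a small ball around \<open>z\<close> in the
  direction of \<open>g\<close>, turns a large norm into a very negative slope \<open>\<langle>g, z - v\<rangle>\<close>: the objective would
  decrease away from \<open>u\<close>, contrary to minimality.
\<close>

lemma minimizer_interior:
  assumes C: "convex C" "C \<subseteq> edom \<omega>" and z: "z \<in> C" "z \<in> interior (edom \<omega>)"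
    and u: "u \<in> C" and min: "\<And>v. v \<in> C \<Longrightarrow> \<omega>\<^sub>r u - p \<bullet> u \<le> \<omega>\<^sub>r v - p \<bullet> v"
  shows "u \<in> interior (edom \<omega>)"
proof (rule ccontr)
  assume nint: "u \<notin> interior (edom \<omega>)"
  with C u have front: "u \<in> frontier (edom \<omega>)"
    unfolding frontier_def using closure_subset by blast
  define t where "t n = 1 / real (n + 2)" for n
  have t: "0 < t n" "t n < 1" for n
    by (simp_all add: t_def)
  have "(\<lambda>n. inverse (real (Suc (Suc n)))) \<longlonglongrightarrow> 0"
    using LIMSEQ_inverse_real_of_nat LIMSEQ_Suc by blast
  then have t0: "t \<longlonglongrightarrow> 0"
    by (simp add: t_def[abs_def] inverse_eq_divide add.commute)
  define v where "v n = u - t n *\<^sub>R (u - z)" for n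
  have v_int: "v n \<in> interior (edom \<omega>)" for n
    unfolding v_def using C u z t[of n]
    by (intro mem_interior_convex_shrink[OF convex_edom]) auto
  have v_C: "v n \<in> C" for n
  proof -
    have "v n = (1 - t n) *\<^sub>R u + t n *\<^sub>R z"
      by (simp add: v_def algebra_simps)
    then show ?thesis
      using C(1) u z t[of n] unfolding convex_alt by simp
  qed
  have "(\<lambda>n. u - t n *\<^sub>R (u - z)) \<longlonglongrightarrow> u - 0 *\<^sub>R (u - z)"
    by (intro tendsto_intros t0)
  then have "v \<longlonglongrightarrow> u"
    by (simp add: v_def[abs_def])
  with legendre v_int front have blow: "filterlim (\<lambda>n. norm (grad \<omega> (v n))) at_top sequentially"
    unfolding legendre_type_def essentially_smooth_def by blast
  \<comment> \<open>Continuity at \<open>z\<close> supplies the ball on which the tangents at \<open>v n\<close> are tested.\<close>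
  obtain r where r: "r > 0" "cball z r \<subseteq> edom \<omega>" "\<And>q. q \<in> cball z r \<Longrightarrow> \<omega>\<^sub>r q \<le> \<omega>\<^sub>r z + 1"
  proof -
    have "isCont \<omega>\<^sub>r z"
      using GDERIV_kernel[OF z(2)] has_derivative_continuous unfolding gderiv_def by blast
    then obtain d where d: "d > 0" "\<And>q. dist q z < d \<Longrightarrow> dist (\<omega>\<^sub>r q) (\<omega>\<^sub>r z) < 1"
      unfolding continuous_at_eps_delta by (metis zero_less_one)
    obtain e where e: "e > 0" "cball z e \<subseteq> edom \<omega>"
      using z(2) unfolding mem_interior_cball by blast
    show ?thesis
    proof (rule that[of "min e (d / 2)"])
      show "min e (d / 2) > 0" "cball z (min e (d / 2)) \<subseteq> edom \<omega>"
        using d e by auto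
      fix q assume "q \<in> cball z (min e (d / 2))"
      then have "dist q z < d"
        using d(1) by (simp add: dist_commute)
      then show "\<omega>\<^sub>r q \<le> \<omega>\<^sub>r z + 1"
        using d(2)[of q] by (simp add: dist_real_def)
    qed
  qed
  \<comment> \<open>The terms come from bounding \<open>\<omega>\<^sub>r (v n)\<close> and the slope towards \<open>z\<close> from below, using minimality of \<open>u\<close>.\<close>
  define B where "B = \<omega>\<^sub>r z + 1 - (\<omega>\<^sub>r u - norm p * norm (z - u)) + norm p * norm (z - u)"
  have bound: "r * norm (grad \<omega> (v n)) \<le> B" for n
  proof -
    let ?g = "grad \<omega> (v n)"
    let ?q = "z + (r / norm ?g) *\<^sub>R ?g"
    have vz: "z - v n = (1 - t n) *\<^sub>R (z - u)" and vu: "v n - u = t n *\<^sub>R (z - u)"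
      by (simp_all add: v_def algebra_simps)
    have small: "\<bar>c * (p \<bullet> (z - u))\<bar> \<le> norm p * norm (z - u)" if "0 \<le> c" "c \<le> 1" for c
    proof -
      have "\<bar>c * (p \<bullet> (z - u))\<bar> \<le> 1 * \<bar>p \<bullet> (z - u)\<bar>"
        unfolding abs_mult using that by (intro mult_right_mono) auto
      then show ?thesis
        using Cauchy_Schwarz_ineq2[of p "z - u"] by simp
    qed
    have "?q \<in> cball z r"
      using r(1) by (cases "?g = 0") (auto simp: dist_norm)
    then have q: "?q \<in> edom \<omega>" "\<omega>\<^sub>r ?q \<le> \<omega>\<^sub>r z + 1"
      using r by blast+
    have "?g \<bullet> ?g = norm ?g * norm ?g"
      by (simp add: dot_square_norm power2_eq_square)
    then have "?g \<bullet> (?q - v n) = ?g \<bullet> (z - v n) + r * norm ?g"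
      by (cases "?g = 0") (simp_all add: algebra_simps)
    then have 1: "\<omega>\<^sub>r (v n) + ?g \<bullet> (z - v n) + r * norm ?g \<le> \<omega>\<^sub>r z + 1"
      using kernel_above_tangent[OF q(1) v_int[of n]] q(2) by simp
    have 2: "\<omega>\<^sub>r u - norm p * norm (z - u) \<le> \<omega>\<^sub>r (v n)"
    proof -
      have "p \<bullet> (v n - u) = t n * (p \<bullet> (z - u))"
        by (simp add: vu)
      then show ?thesis
        using min[OF v_C[of n]] small[of "t n"] t[of n] by (simp add: inner_diff_right)
    qed
    \<comment> \<open>Optimality of \<open>u\<close> and the tangent at \<open>v n\<close> force the slope towards \<open>z\<close> to be at least that of \<open>p\<close>.\<close>
    have 3: "- (norm p * norm (z - u)) \<le> ?g \<bullet> (z - v n)"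
    proof -
      have "\<omega>\<^sub>r (v n) + ?g \<bullet> (u - v n) \<le> \<omega>\<^sub>r u"
        using u C v_int by (intro kernel_above_tangent) auto
      with min[OF v_C[of n]] have "?g \<bullet> (u - v n) \<le> p \<bullet> (u - v n)"
        by (simp add: inner_diff_right)
      then have "p \<bullet> (v n - u) \<le> ?g \<bullet> (v n - u)"
        by (simp add: inner_diff_right)
      then have "t n * (p \<bullet> (z - u)) \<le> t n * (?g \<bullet> (z - u))"
        by (simp add: vu)
      then have "p \<bullet> (z - u) \<le> ?g \<bullet> (z - u)"
        using t[of n] by (simp only: mult_le_cancel_left_pos)
      then have "(1 - t n) * (p \<bullet> (z - u)) \<le> (1 - t n) * (?g \<bullet> (z - u))"
        using t[of n] by (intro mult_left_mono) auto
      then show ?thesis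
        using small[of "1 - t n"] t[of n] by (simp only: vz inner_scaleR_right) linarith
    qed
    from 1 2 3 show ?thesis
      by (simp add: B_def)
  qed
  have "eventually (\<lambda>n. norm (grad \<omega> (v n)) > B / r) sequentially"
    using blow unfolding filterlim_at_top_dense by blast
  then obtain n where "norm (grad \<omega> (v n)) > B / r"
    unfolding eventually_sequentially by blast
  with bound[of n] r(1) show False
    by (simp add: field_simps)
qed

lemma minimizer_variational:
  assumes C: "convex C" and u: "u \<in> C" "u \<in> interior (edom \<omega>)" and v: "v \<in> C"
    and min: "\<And>v. v \<in> C \<Longrightarrow> \<omega>\<^sub>r u - p \<bullet> u \<le> \<omega>\<^sub>r v - p \<bullet> v"
  shows "0 \<le> (grad \<omega> u - p) \<bullet> (v - u)"
proof -
  have lim: "((\<lambda>t. (\<omega>\<^sub>r (u + t *\<^sub>R (v - u)) - \<omega>\<^sub>r u) / t) \<longlongrightarrow> grad \<omega> u \<bullet> (v - u)) (at_right 0)"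
    by (rule kernel_difference_quotient[OF u(2)])
  have "p \<bullet> (v - u) \<le> (\<omega>\<^sub>r (u + t *\<^sub>R (v - u)) - \<omega>\<^sub>r u) / t" if t: "0 < t" "t < 1" for t
  proof -
    have "u + t *\<^sub>R (v - u) = (1 - t) *\<^sub>R u + t *\<^sub>R v"
      by (simp add: algebra_simps)
    then have "u + t *\<^sub>R (v - u) \<in> C"
      using C u v t unfolding convex_alt by simp
    from min[OF this] show ?thesis
      using t by (simp only: inner_add_right inner_scaleR_right pos_le_divide_eq) (simp add: mult.commute)
  qed
  then have "eventually (\<lambda>t. p \<bullet> (v - u) \<le> (\<omega>\<^sub>r (u + t *\<^sub>R (v - u)) - \<omega>\<^sub>r u) / t) (at_right 0)"
    unfolding eventually_at_right_field by (intro exI[of _ 1]) auto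
  from tendsto_lowerbound[OF lim this] show ?thesis
    by (simp add: inner_diff_left)
qed

text \<open>
  The solution is the minimiser of \<open>\<omega> - \<langle>p, \<cdot>\<rangle>\<close>. It is found by minimising the continuous function
  \<open>c - \<langle>p, x\<rangle>\<close> over a piece of the epigraph, which is closed by hypothesis and bounded by strong
  convexity; passing to the epigraph lets its closedness act in place of lower semicontinuity.
\<close>

lemma grad_surjective: "\<exists>u \<in> interior (edom \<omega>). grad \<omega> u = p"
proof -
  obtain z where z: "z \<in> interior (edom \<omega>)"
    using legendre unfolding legendre_type_def essentially_smooth_def by blast
  let ?g = "grad \<omega> z"
  \<comment> \<open>The part of the epigraph on which the objective is at most its value at \<open>z\<close>.\<close>
  define K where "K = {(x, c :: real). \<omega> x \<le> ereal c} \<inter> {q. snd q \<le> \<omega>\<^sub>r z + p \<bullet> (fst q - z)}"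
  have "closed K"
  proof -
    have "closed {q :: 'a \<times> real. snd q \<le> \<omega>\<^sub>r z + p \<bullet> (fst q - z)}"
      by (intro closed_Collect_le continuous_intros)
    then show ?thesis
      using legendre unfolding K_def legendre_type_def closed_fun_def by blast
  qed
  define R where "R = 2 * norm (p - ?g) / \<mu>"
  have K: "x \<in> edom \<omega>" "norm (x - z) \<le> R"
    "\<omega>\<^sub>r x \<le> c" "c \<le> \<omega>\<^sub>r z + p \<bullet> (x - z)" "\<omega>\<^sub>r z + ?g \<bullet> (x - z) \<le> c"
    if "(x, c) \<in> K" for x c
  proof -
    have le: "\<omega> x \<le> ereal c" and c: "c \<le> \<omega>\<^sub>r z + p \<bullet> (x - z)"
      using that by (auto simp: K_def)
    from le show dom: "x \<in> edom \<omega>"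
      unfolding edom_def using le_less_trans by auto
    from le show xc: "\<omega>\<^sub>r x \<le> c"
      by (subst (asm) kernel_real[OF dom, symmetric]) simp
    show "c \<le> \<omega>\<^sub>r z + p \<bullet> (x - z)"
      by (rule c)
    show "\<omega>\<^sub>r z + ?g \<bullet> (x - z) \<le> c"
      using kernel_above_tangent[OF dom z] xc by simp
    have "\<mu> / 2 * (norm (x - z))\<^sup>2 \<le> (p - ?g) \<bullet> (x - z)"
      using bregman_lower[OF dom z] xc c by (simp add: bregman_def inner_diff_left)
    also have "\<dots> \<le> norm (p - ?g) * norm (x - z)"
      by (rule norm_cauchy_schwarz)
    finally have "\<mu> / 2 * norm (x - z) * norm (x - z) \<le> norm (p - ?g) * norm (x - z)"
      by (simp add: power2_eq_square)
    then have "\<mu> / 2 * norm (x - z) \<le> norm (p - ?g)"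
      by (cases "x = z") auto
    then show "norm (x - z) \<le> R"
      using mu_pos by (simp add: R_def field_simps)
  qed
  have "bounded K"
    unfolding bounded_iff
  proof (intro exI ballI)
    fix q assume q: "q \<in> K"
    obtain x c where xc: "q = (x, c)"
      by (cases q)
    note K' = K[OF q[unfolded xc]]
    have "\<bar>p \<bullet> (x - z)\<bar> \<le> norm p * R" "\<bar>?g \<bullet> (x - z)\<bar> \<le> norm ?g * R"
      using Cauchy_Schwarz_ineq2[of p "x - z"] Cauchy_Schwarz_ineq2[of ?g "x - z"]
        mult_left_mono[OF K'(2), of "norm p"] mult_left_mono[OF K'(2), of "norm ?g"]
      by (auto intro: order_trans)
    moreover have "0 \<le> norm p * R" "0 \<le> norm ?g * R"
      using mu_pos by (auto simp: R_def)
    ultimately have "\<bar>c\<bar> \<le> \<bar>\<omega>\<^sub>r z\<bar> + norm p * R + norm ?g * R"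
      using K'(4,5) abs_ge_self[of "\<omega>\<^sub>r z"] abs_ge_minus_self[of "\<omega>\<^sub>r z"]
      unfolding abs_le_iff by linarith
    moreover have "norm x \<le> norm z + R"
      using K'(2) norm_triangle_ineq2[of x z] by simp
    ultimately show "norm q \<le> (norm z + R) + (\<bar>\<omega>\<^sub>r z\<bar> + norm p * R + norm ?g * R)"
      using norm_Pair_le[of x c] by (simp add: xc)
  qed
  with \<open>closed K\<close> have "compact K"
    by (simp add: compact_eq_bounded_closed)
  have zK: "(z, \<omega>\<^sub>r z) \<in> K"
    using kernel_real[OF interior_edom[OF z]] by (simp add: K_def)
  obtain u c where uc: "(u, c) \<in> K" "\<And>x d. (x, d) \<in> K \<Longrightarrow> c - p \<bullet> u \<le> d - p \<bullet> x"
  proof -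
    have "\<exists>q\<in>K. \<forall>q'\<in>K. snd q - p \<bullet> fst q \<le> snd q' - p \<bullet> fst q'"
      using zK \<open>compact K\<close>
      by (intro continuous_attains_inf continuous_intros) auto
    then show ?thesis
      using that by (metis fst_conv snd_conv surj_pair)
  qed
  have min: "\<omega>\<^sub>r u - p \<bullet> u \<le> \<omega>\<^sub>r v - p \<bullet> v" if v: "v \<in> edom \<omega>" for v
  proof (cases "\<omega>\<^sub>r v \<le> \<omega>\<^sub>r z + p \<bullet> (v - z)")
    case True
    then have "(v, \<omega>\<^sub>r v) \<in> K"
      using kernel_real[OF v] by (simp add: K_def)
    from uc(2)[OF this] K(3)[OF uc(1)] show ?thesis
      by simp
  next
    case False
    then show ?thesis
      using uc(2)[OF zK] K(3)[OF uc(1)] by (simp add: inner_diff_right)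
  qed
  have u: "u \<in> interior (edom \<omega>)"
    by (rule minimizer_interior[OF convex_edom subset_refl interior_edom[OF z] z
          K(1)[OF uc(1)] min])
  \<comment> \<open>An interior minimiser admits a small step against the residual gradient.\<close>
  obtain e where e: "e > 0" "cball u e \<subseteq> edom \<omega>"
    using u unfolding mem_interior_cball by blast
  define r where "r = grad \<omega> u - p"
  have "r = 0"
  proof (rule ccontr)
    assume r: "r \<noteq> 0"
    let ?v = "u - (e / norm r) *\<^sub>R r"
    have "?v \<in> edom \<omega>"
      using e r by (intro subsetD[OF e(2)]) (simp add: dist_norm)
    from minimizer_variational[OF convex_edom interior_edom[OF u] u this min]
    have "0 \<le> r \<bullet> (?v - u)"
      unfolding r_def .
    moreover have "0 < (e / norm r) * (r \<bullet> r)"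
      using e r by (intro mult_pos_pos) auto
    ultimately show False
      by simp
  qed
  with u show ?thesis
    by (auto simp: r_def)
qed

text \<open>
  With \<open>p = \<nabla>\<omega>(u)\<close>, testing the supremum at \<open>u\<close> bounds \<open>\<omega>\<^sup>*\<close> from below by an affine function with
  slope \<open>u\<close>, and strong convexity at \<open>u\<close> bounds it from above by the same function plus
  \<open>\<parallel>q - p\<parallel>\<^sup>2 / (2 \<mu>)\<close>. Both bounds agree at \<open>p\<close> to first order.
\<close>

lemma grad_conjugate:
  assumes u: "u \<in> interior (edom \<omega>)"
  shows "grad (convex_conjugate \<omega>) (grad \<omega> u) = u"
proof -
  let ?p = "grad \<omega> u" and ?f = "\<lambda>q. real_of_ereal (convex_conjugate \<omega> q)"
  let ?c = "?p \<bullet> u - \<omega>\<^sub>r u"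
  have lower: "ereal (q \<bullet> u - \<omega>\<^sub>r u) \<le> convex_conjugate \<omega> q" for q
  proof -
    have "ereal (q \<bullet> u) - \<omega> u \<le> convex_conjugate \<omega> q"
      unfolding convex_conjugate_def by (rule SUP_upper) simp
    then show ?thesis
      by (subst (asm) kernel_real[OF interior_edom[OF u], symmetric]) simp
  qed
  have upper: "convex_conjugate \<omega> q \<le> ereal (?c + (q - ?p) \<bullet> u + (norm (q - ?p))\<^sup>2 / (2 * \<mu>))" for q
    unfolding convex_conjugate_def
  proof (rule SUP_least)
    fix v
    show "ereal (q \<bullet> v) - \<omega> v \<le> ereal (?c + (q - ?p) \<bullet> u + (norm (q - ?p))\<^sup>2 / (2 * \<mu>))"
    proof (cases "v \<in> edom \<omega>")
      case True
      let ?n = "norm (q - ?p)" and ?d = "norm (v - u)"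
      have "(q - ?p) \<bullet> (v - u) - \<mu> / 2 * ?d\<^sup>2 \<le> ?n * ?d - \<mu> / 2 * ?d\<^sup>2"
        using norm_cauchy_schwarz[of "q - ?p" "v - u"] by simp
      also have "\<dots> = (?n\<^sup>2 - (?n - \<mu> * ?d)\<^sup>2) / (2 * \<mu>)"
        using mu_pos by (simp add: field_simps power2_eq_square)
      also have "\<dots> \<le> ?n\<^sup>2 / (2 * \<mu>)"
        using mu_pos by (intro divide_right_mono) auto
      finally have "q \<bullet> v - \<omega>\<^sub>r v \<le> ?c + (q - ?p) \<bullet> u + ?n\<^sup>2 / (2 * \<mu>)"
        using bregman_lower[OF True u] by (simp add: bregman_def algebra_simps)
      then show ?thesis
        by (subst kernel_real[OF True, symmetric]) simp
    next
      case False
      then show ?thesis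
        by (simp add: edom_def)
    qed
  qed
  have f: "ereal (?f q) = convex_conjugate \<omega> q" for q
    using lower[of q] upper[of q] by (cases "convex_conjugate \<omega> q") auto
  have f_lower: "?c + (q - ?p) \<bullet> u \<le> ?f q" for q
    using lower[of q] by (subst (asm) f[symmetric]) (simp add: inner_diff_left)
  have f_upper: "?f q \<le> ?c + (q - ?p) \<bullet> u + (norm (q - ?p))\<^sup>2 / (2 * \<mu>)" for q
    using upper[of q] by (subst (asm) f[symmetric]) simp
  have fp: "?f ?p = ?c"
    using f_lower[of ?p] f_upper[of ?p] by simp
  have "GDERIV ?f ?p :> u"
    unfolding gderiv_def has_derivative_at
  proof
    show "bounded_linear (\<lambda>h. h \<bullet> u)"
      by (rule bounded_linear_inner_left)
    show "(\<lambda>h. norm (?f (?p + h) - ?f ?p - h \<bullet> u) / norm h) \<midarrow>0\<rightarrow> 0"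
    proof (rule Lim_null_comparison)
      show "(\<lambda>h::'a. norm h / (2 * \<mu>)) \<midarrow>0\<rightarrow> 0"
        by (intro tendsto_divide_zero tendsto_norm_zero tendsto_ident_at)
      show "\<forall>\<^sub>F h in at 0. norm (norm (?f (?p + h) - ?f ?p - h \<bullet> u) / norm h) \<le> norm h / (2 * \<mu>)"
      proof (intro always_eventually allI)
        fix h :: 'a
        have "norm (?f (?p + h) - ?f ?p - h \<bullet> u) \<le> (norm h)\<^sup>2 / (2 * \<mu>)"
          using f_lower[of "?p + h"] f_upper[of "?p + h"] by (simp add: fp)
        then show "norm (norm (?f (?p + h) - ?f ?p - h \<bullet> u) / norm h) \<le> norm h / (2 * \<mu>)"
          by (cases "h = 0") (simp_all add: divide_le_eq power2_eq_square)
      qed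
    qed
  qed
  then show ?thesis
    by (rule grad_eqI)
qed

section \<open>Proximal, inertial and extragradient steps\<close>

text \<open>
  First-order optimality of a proximal step, rewritten with the three-point identity. The case \<open>c = 0\<close>
  is the Bregman projection.
\<close>

lemma prox_step:
  assumes C: "convex C" "C \<subseteq> edom \<omega>" and z: "z \<in> C" "z \<in> interior (edom \<omega>)"
    and argmin: "is_arg_min (\<lambda>v. c \<bullet> v + D\<^sub>\<omega> v w) (\<lambda>v. v \<in> C) q"
  shows "q \<in> C" and "q \<in> interior (edom \<omega>)"
    and "u \<in> C \<Longrightarrow> c \<bullet> (q - u) \<le> D\<^sub>\<omega> u w - D\<^sub>\<omega> u q - D\<^sub>\<omega> q w"
proof -
  show q: "q \<in> C"
    using argmin by (simp add: is_arg_min_def)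
  have min: "\<omega>\<^sub>r q - (grad \<omega> w - c) \<bullet> q \<le> \<omega>\<^sub>r v - (grad \<omega> w - c) \<bullet> v" if "v \<in> C" for v
  proof -
    have "c \<bullet> q + D\<^sub>\<omega> q w \<le> c \<bullet> v + D\<^sub>\<omega> v w"
      using argmin that by (simp add: is_arg_min_linorder)
    then show ?thesis
      by (simp add: bregman_def algebra_simps)
  qed
  show int: "q \<in> interior (edom \<omega>)"
    by (rule minimizer_interior[OF C z q min])
  show "c \<bullet> (q - u) \<le> D\<^sub>\<omega> u w - D\<^sub>\<omega> u q - D\<^sub>\<omega> q w" if "u \<in> C"
    using minimizer_variational[OF C(1) q int that min] three_point[of u w q]
    by (simp add: algebra_simps)
qed

lemma mirror_point:
  assumes "w = grad (convex_conjugate \<omega>) p"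
  shows "w \<in> interior (edom \<omega>)" and "grad \<omega> w = p"
  using grad_surjective[of p] grad_conjugate assms by auto

text \<open>
  The combination \<open>D\<^sub>\<omega> u w - (1 + a) D\<^sub>\<omega> u x + a D\<^sub>\<omega> u x'\<close> does not depend on \<open>u\<close>. At \<open>u = x\<close> it is
  \<open>D\<^sub>\<omega> x w + a D\<^sub>\<omega> x x'\<close>, and both terms are controlled by the distance of the gradients.
\<close>

lemma inertial_bregman_bound:
  assumes "x \<in> interior (edom \<omega>)" "x' \<in> interior (edom \<omega>)" "w \<in> interior (edom \<omega>)"
    and a: "a \<ge> 0" and w: "grad \<omega> w = (1 + a) *\<^sub>R grad \<omega> x - a *\<^sub>R grad \<omega> x'"
  shows "D\<^sub>\<omega> u w \<le> D\<^sub>\<omega> u x + a * (D\<^sub>\<omega> u x - D\<^sub>\<omega> u x')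
    + a * (1 + a) / (2 * \<mu>) * (norm (grad \<omega> x - grad \<omega> x'))\<^sup>2"
proof -
  let ?g = "grad \<omega> x - grad \<omega> x'"
  have diff: "grad \<omega> x - grad \<omega> w = (- a) *\<^sub>R ?g"
    by (simp add: w algebra_simps)
  have "D\<^sub>\<omega> x w \<le> (norm (grad \<omega> x - grad \<omega> w))\<^sup>2 / (2 * \<mu>)"
    using assms by (intro bregman_upper)
  then have 1: "D\<^sub>\<omega> x w \<le> a\<^sup>2 * (norm ?g)\<^sup>2 / (2 * \<mu>)"
    unfolding diff by (simp add: power_mult_distrib)
  have 2: "a * D\<^sub>\<omega> x x' \<le> a * ((norm ?g)\<^sup>2 / (2 * \<mu>))"
    using a assms by (intro mult_left_mono bregman_upper)
  have "D\<^sub>\<omega> u w = D\<^sub>\<omega> u x + D\<^sub>\<omega> x w - a * (?g \<bullet> (u - x))"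
    using three_point[of u w x] by (simp only: diff inner_scaleR_left)
  also have "?g \<bullet> (u - x) = D\<^sub>\<omega> u x' - D\<^sub>\<omega> u x - D\<^sub>\<omega> x x'"
    using three_point[of u x' x] by simp
  finally have "D\<^sub>\<omega> u w = D\<^sub>\<omega> u x + a * (D\<^sub>\<omega> u x - D\<^sub>\<omega> u x') + (D\<^sub>\<omega> x w + a * D\<^sub>\<omega> x x')"
    by (simp add: algebra_simps)
  also have "\<dots> \<le> D\<^sub>\<omega> u x + a * (D\<^sub>\<omega> u x - D\<^sub>\<omega> u x')
      + (a\<^sup>2 * (norm ?g)\<^sup>2 / (2 * \<mu>) + a * ((norm ?g)\<^sup>2 / (2 * \<mu>)))"
    using 1 2 by simp
  also have "a\<^sup>2 * (norm ?g)\<^sup>2 / (2 * \<mu>) + a * ((norm ?g)\<^sup>2 / (2 * \<mu>))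
      = a * (1 + a) / (2 * \<mu>) * (norm ?g)\<^sup>2"
    using mu_pos by (simp add: field_simps power2_eq_square)
  finally show ?thesis .
qed

text \<open>
  The proximal inequalities for \<open>y\<close> (tested at \<open>x\<close>) and for \<open>x\<close> (tested at \<open>u\<close>) add up to the
  claim apart from \<open>lam \<langle>G y - G w', y - x\<rangle>\<close>. By the Lipschitz condition this is at most
  \<open>\<mu> \<parallel>y - w'\<parallel> \<parallel>y - x\<parallel>\<close>, which the spare terms \<open>D\<^sub>\<omega> y w\<close> and \<open>D\<^sub>\<omega> x y\<close> absorb; the former
  dominates \<open>D\<^sub>\<omega> y w'\<close> because \<open>w'\<close> is the projection of \<open>w\<close> onto a set containing \<open>y\<close>.
\<close>

lemma extragradient_step:
  assumes X: "convex X" "X \<subseteq> \<Omega>" and \<Omega>: "convex \<Omega>" "\<Omega> \<subseteq> edom \<omega>"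
    and z: "z \<in> X" "z \<in> interior (edom \<omega>)" and w: "w \<in> interior (edom \<omega>)"
    and G: "L-lipschitz_on (edom \<omega>) G" and lam: "lam \<ge> 0" "lam * L \<le> \<mu>"
    and w': "is_arg_min (\<lambda>v. D\<^sub>\<omega> v w) (\<lambda>v. v \<in> \<Omega>) w'"
    and y: "is_arg_min (\<lambda>v. lam * (G w' \<bullet> v) + D\<^sub>\<omega> v w) (\<lambda>v. v \<in> X) y"
    and x: "is_arg_min (\<lambda>v. lam * (G y \<bullet> v) + D\<^sub>\<omega> v w) (\<lambda>v. v \<in> X) x"
  shows "y \<in> X" and "x \<in> X \<inter> interior (edom \<omega>)"
    and "u \<in> X \<Longrightarrow> lam * (G y \<bullet> (y - u)) \<le> D\<^sub>\<omega> u w - D\<^sub>\<omega> u x"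
proof -
  have XE: "X \<subseteq> edom \<omega>"
    using X \<Omega> by blast
  have w'_min: "is_arg_min (\<lambda>v. 0 \<bullet> v + D\<^sub>\<omega> v w) (\<lambda>v. v \<in> \<Omega>) w'"
    using w' by simp
  have y_min: "is_arg_min (\<lambda>v. (lam *\<^sub>R G w') \<bullet> v + D\<^sub>\<omega> v w) (\<lambda>v. v \<in> X) y"
    and x_min: "is_arg_min (\<lambda>v. (lam *\<^sub>R G y) \<bullet> v + D\<^sub>\<omega> v w) (\<lambda>v. v \<in> X) x"
    using y x by simp_all
  note pw = prox_step[OF \<Omega> subsetD[OF X(2) z(1)] z(2) w'_min]
  note py = prox_step[OF X(1) XE z y_min]
  note px = prox_step[OF X(1) XE z x_min]
  show y_in: "y \<in> X" and x_in: "x \<in> X \<inter> interior (edom \<omega>)"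
    using py px by auto
  assume u: "u \<in> X"
  let ?a = "norm (y - w')" and ?b = "norm (y - x)"
  have "norm (G y - G w') \<le> L * ?a"
    using lipschitz_onD[OF G, of y w'] y_in XE pw(1) \<Omega> by (auto simp: dist_norm)
  then have "(G y - G w') \<bullet> (y - x) \<le> L * ?a * ?b"
    using norm_cauchy_schwarz[of "G y - G w'" "y - x"] mult_right_mono[of _ _ ?b]
    by (meson norm_ge_zero order_trans)
  then have "lam * ((G y - G w') \<bullet> (y - x)) \<le> lam * (L * ?a * ?b)"
    using lam by (intro mult_left_mono)
  also have "\<dots> = (lam * L) * (?a * ?b)"
    by simp
  also have "\<dots> \<le> \<mu> * (?a * ?b)"
    using lam by (intro mult_right_mono) auto
  also have "\<dots> \<le> \<mu> / 2 * ?a\<^sup>2 + \<mu> / 2 * ?b\<^sup>2"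
  proof -
    have "0 \<le> \<mu> / 2 * (?a - ?b)\<^sup>2"
      using mu_pos by simp
    then show ?thesis
      by (simp add: power2_eq_square algebra_simps)
  qed
  also have "\<mu> / 2 * ?a\<^sup>2 \<le> D\<^sub>\<omega> y w"
  proof -
    have "D\<^sub>\<omega> y w' + D\<^sub>\<omega> w' w \<le> D\<^sub>\<omega> y w"
      using pw(3)[of y] y_in X by auto
    moreover have "\<mu> / 2 * ?a\<^sup>2 \<le> D\<^sub>\<omega> y w'"
      using y_in XE pw(2) by (intro bregman_lower) auto
    moreover have "0 \<le> D\<^sub>\<omega> w' w"
      using pw(1) \<Omega> w by (intro bregman_nonneg) auto
    ultimately show ?thesis
      by simp
  qed
  also have "\<mu> / 2 * ?b\<^sup>2 \<le> D\<^sub>\<omega> x y"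
    using bregman_lower[of x y] x_in XE py(2) by (auto simp: norm_minus_commute)
  finally have "lam * ((G y - G w') \<bullet> (y - x)) \<le> D\<^sub>\<omega> y w + D\<^sub>\<omega> x y"
    by simp
  moreover have "lam * (G w' \<bullet> (y - x)) \<le> D\<^sub>\<omega> x w - D\<^sub>\<omega> x y - D\<^sub>\<omega> y w"
    using py(3)[of x] x_in by simp
  moreover have "lam * (G y \<bullet> (x - u)) \<le> D\<^sub>\<omega> u w - D\<^sub>\<omega> u x - D\<^sub>\<omega> x w"
    using px(3)[OF u] by simp
  moreover have "lam * (G y \<bullet> (y - u))
      = lam * ((G y - G w') \<bullet> (y - x)) + lam * (G w' \<bullet> (y - x)) + lam * (G y \<bullet> (x - u))"
    by (simp add: algebra_simps)
  ultimately show "lam * (G y \<bullet> (y - u)) \<le> D\<^sub>\<omega> u w - D\<^sub>\<omega> u x"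
    by linarith
qed

end

section \<open>Summation and averaging\<close>

text \<open>
  After summation by parts every energy occurs with a nonnegative coefficient, apart from the last one,
  so it may be replaced by its bound \<open>M\<close>, and the coefficients telescope. The index type is \<open>int\<close>
  because the inertia reaches back to the index \<open>-1\<close>.
\<close>

lemma inertial_abel_bound:
  fixes \<phi> :: "int \<Rightarrow> real" and c a :: "nat \<Rightarrow> real"
  assumes k: "k \<ge> 1" and \<phi>: "\<And>i. i \<ge> 0 \<Longrightarrow> 0 \<le> \<phi> i" "\<And>i. i \<ge> 0 \<Longrightarrow> \<phi> i \<le> M" "\<phi> (-1) = \<phi> 0"
    and c: "\<And>j. c j \<le> c (Suc j)" and a: "\<And>j. a (Suc j) \<le> a j" "\<And>j. 0 \<le> a j" "a 0 \<le> c 0"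
  shows "(\<Sum>j<k. c j * (\<phi> (int j) - \<phi> (int j + 1)) + a j * (\<phi> (int j) - \<phi> (int j - 1)))
    \<le> c (k - 1) * M"
proof -
  let ?S = "\<lambda>k. \<Sum>j<k. c j * (\<phi> (int j) - \<phi> (int j + 1)) + a j * (\<phi> (int j) - \<phi> (int j - 1))"
  \<comment> \<open>Since \<open>a\<close> is nonnegative, so is \<open>c\<close>.\<close>
  have ac: "a j \<le> c j" for j
    using lift_Suc_antimono_le[of a 0 j] lift_Suc_mono_le[of c 0 j] a c
    by (meson le0 order_trans)
  \<comment> \<open>The term with \<open>\<phi> (int n)\<close> on the right is kept: the next inertia term cancels part of it.\<close>
  have main: "?S (Suc n) + c n * \<phi> (int n + 1) \<le> (c n - a n) * M + a n * \<phi> (int n)" for n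
  proof (induction n)
    case 0
    have "(c 0 - a 0) * \<phi> 0 \<le> (c 0 - a 0) * M"
      using \<phi> a by (intro mult_left_mono) auto
    then show ?case
      by (simp add: \<phi>(3) algebra_simps)
  next
    case (Suc n)
    let ?p = "\<phi> (int n)" and ?q = "\<phi> (int n + 1)"
    have idx: "int (Suc n) = int n + 1"
      by simp
    have "?S (Suc (Suc n)) + c (Suc n) * \<phi> (int (Suc n) + 1)
        = ?S (Suc n) + c (Suc n) * ?q + a (Suc n) * (?q - ?p)"
      by (simp only: sum.lessThan_Suc[of _ "Suc n"] idx) (simp add: algebra_simps)
    also have "\<dots> \<le> (c n - a n) * M + a n * ?p + (c (Suc n) - c n) * ?q + a (Suc n) * (?q - ?p)"
      using Suc.IH by (simp add: algebra_simps)
    also have "\<dots> = (c n - a n) * M + (c (Suc n) - c n) * ?q + (a n - a (Suc n)) * ?p + a (Suc n) * ?q"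
      by (simp add: algebra_simps)
    also have "\<dots> \<le> (c n - a n) * M + (c (Suc n) - c n) * M + (a n - a (Suc n)) * M + a (Suc n) * ?q"
      using \<phi> c a by (intro add_mono mult_left_mono order_refl) auto
    also have "\<dots> = (c (Suc n) - a (Suc n)) * M + a (Suc n) * \<phi> (int (Suc n))"
      by (simp only: idx) (simp add: algebra_simps)
    finally show ?case .
  qed
  obtain n where n: "k = Suc n"
    using k by (cases k) auto
  have c0: "0 \<le> c n"
    using a(2) ac order_trans by blast
  have "0 \<le> c n * \<phi> (int n + 1)"
    using c0 \<phi> by simp
  moreover have "a n * \<phi> (int n) \<le> a n * M"
    using a \<phi> by (intro mult_left_mono) auto
  ultimately show ?thesis
    using main[of n] by (simp add: n algebra_simps)
qed

text \<open>
  The step of the induction is the weighted arithmetic-geometric mean inequality for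
  \<open>k\<close> and \<open>k + 1\<close> with weights \<open>1 - b\<close> and \<open>b\<close>, divided by \<open>(k + 1)\<^sup>b\<close>.
\<close>

lemma powr_sum_bound:
  assumes b: "0 < b" "b < 1"
  shows "(\<Sum>j<k. 1 / real (j + 1) powr b) \<le> real k powr (1 - b) / (1 - b)"
proof (induction k)
  case 0
  then show ?case by simp
next
  case (Suc k)
  let ?m = "real (Suc k)"
  have "real k powr (1 - b) * ?m powr b \<le> (1 - b) * real k + b * ?m"
  proof (cases "k = 0")
    case True
    then show ?thesis using b by simp
  next
    case False
    then show ?thesis
      using b by (intro Youngs_inequality_0) auto
  qed
  also have "\<dots> = ?m powr (1 - b) * ?m powr b - (1 - b)"
    by (simp add: powr_add[symmetric] algebra_simps)
  finally have "((1 - b) + real k powr (1 - b) * ?m powr b) / ?m powr b \<le> ?m powr (1 - b)"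
    by (simp add: divide_le_eq)
  then have "(1 - b) / ?m powr b + real k powr (1 - b) \<le> ?m powr (1 - b)"
    by (simp add: add_divide_distrib)
  then have "((1 - b) / ?m powr b + real k powr (1 - b)) / (1 - b) \<le> ?m powr (1 - b) / (1 - b)"
    using b by (intro divide_right_mono) auto
  then have "1 / ?m powr b + real k powr (1 - b) / (1 - b) \<le> ?m powr (1 - b) / (1 - b)"
    using b by (simp add: add_divide_distrib)
  with Suc.IH show ?case
    by (simp add: add.commute)
qed

text \<open>
  The weighted sum may be negative, so the sum of the weights can be replaced by its lower bound only
  after the numerator has been bounded by the nonnegative \<open>N\<close>.
\<close>

lemma weighted_average_bound:
  fixes y :: "nat \<Rightarrow> 'a::real_inner"
  assumes k: "k \<ge> 1" and lo: "lo > 0" "\<And>j. lo \<le> lam j" and N: "0 \<le> N"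
    and sum: "(\<Sum>j<k. lam j * (g \<bullet> (y j - u))) \<le> N"
  shows "g \<bullet> ((1 / (\<Sum>j<k. lam j)) *\<^sub>R (\<Sum>j<k. lam j *\<^sub>R y j) - u) \<le> N / (real k * lo)"
proof -
  let ?\<Lambda> = "\<Sum>j<k. lam j"
  have \<Lambda>: "real k * lo \<le> ?\<Lambda>"
    using sum_mono[of "{..<k}" "\<lambda>_. lo" lam] lo by simp
  have pos: "0 < real k * lo"
    using k lo by simp
  have "g \<bullet> ((1 / ?\<Lambda>) *\<^sub>R (\<Sum>j<k. lam j *\<^sub>R y j) - u) = (\<Sum>j<k. lam j * (g \<bullet> (y j - u))) / ?\<Lambda>"
    using \<Lambda> pos
    by (simp add: inner_diff_right inner_sum_right right_diff_distrib sum_subtractf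
        flip: sum_distrib_right) (simp add: field_simps)
  also have "\<dots> \<le> N / ?\<Lambda>"
    using sum \<Lambda> pos by (intro divide_right_mono) auto
  also have "\<dots> \<le> N / (real k * lo)"
    using \<Lambda> pos N by (intro divide_left_mono) auto
  finally show ?thesis .
qed

section \<open>Lower bounds for the dual gap\<close>

text \<open>
  The distance to \<open>Q\<close> is approached by points of \<open>Q\<close> up to a small error, which is chosen so that
  \<open>B\<close> times the error is below \<open>e\<close>; the denominator \<open>B + 1\<close> covers \<open>B = 0\<close>.
\<close>

lemma dual_gap_ge_infdist:
  assumes Q: "Q \<noteq> {}" and B: "\<And>q. q \<in> Q \<Longrightarrow> norm (H q) \<le> B"
  shows "ereal (- B * infdist z Q) \<le> dual_gap z H Q"
proof (rule ereal_le_epsilon2)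
  have B0: "0 \<le> B"
    using Q B norm_ge_zero order_trans by blast
  fix e :: real
  assume e: "0 < e"
  show "ereal (- B * infdist z Q) \<le> dual_gap z H Q + ereal e"
  proof -
    have "infdist z Q < infdist z Q + e / (B + 1)"
      using e B0 by simp
    then obtain q where q: "q \<in> Q" "dist z q < infdist z Q + e / (B + 1)"
      using Q by (metis cINF_less_iff bdd_below_image_dist infdist_notempty)
    have "- (H q \<bullet> (z - q)) \<le> norm (H q) * dist z q"
      using Cauchy_Schwarz_ineq2[of "H q" "z - q"] by (simp add: dist_norm)
    also have "\<dots> \<le> B * (infdist z Q + e / (B + 1))"
      using q B[OF q(1)] B0 by (intro mult_mono) auto
    also have "\<dots> \<le> B * infdist z Q + e"
      using e B0 by (simp add: field_simps)
    finally have "ereal (- B * infdist z Q) \<le> ereal (H q \<bullet> (z - q)) + ereal e"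
      by simp
    also have "\<dots> \<le> dual_gap z H Q + ereal e"
      unfolding dual_gap_def using q by (intro add_right_mono SUP_upper)
    finally show ?thesis .
  qed
qed

lemma weakly_sharp_infdist_bound:
  assumes sharp: "weakly_sharp F X \<sigma> M" and ne: "vi_solutions F X \<noteq> {}" and z: "z \<in> X"
    and gap: "dual_gap z F X \<le> ereal N"
  shows "infdist z (vi_solutions F X) \<le> N powr (1 / M) / \<sigma> powr (1 / M)"
proof -
  let ?d = "infdist z (vi_solutions F X)"
  have \<sigma>: "\<sigma> > 0" and M: "M \<ge> 1"
    using sharp by (auto simp: weakly_sharp_def)
  obtain q where q: "q \<in> vi_solutions F X"
    using ne by blast
  then have "\<sigma> * ?d powr M \<le> F q \<bullet> (z - q)"
    using sharp z by (auto simp: weakly_sharp_def)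
  moreover have "ereal (F q \<bullet> (z - q)) \<le> ereal N"
    using q gap unfolding dual_gap_def vi_solutions_def by (auto simp: SUP_le_iff)
  ultimately have "?d powr M \<le> N / \<sigma>"
    using \<sigma> by (simp add: field_simps)
  then have "(?d powr M) powr (1 / M) \<le> (N / \<sigma>) powr (1 / M)"
    using M by (intro powr_mono2) auto
  moreover have "0 \<le> N"
  proof -
    have "0 \<le> N / \<sigma>"
      using \<open>?d powr M \<le> N / \<sigma>\<close> powr_ge_zero[of ?d M] by linarith
    then show ?thesis
      using \<sigma> by (simp add: zero_le_divide_iff)
  qed
  ultimately show ?thesis
    using M \<sigma> infdist_nonneg[of z "vi_solutions F X"] by (simp add: powr_powr powr_divide)
qed

section \<open>Energy estimates along a run of the algorithm\<close>

text \<open>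
  The step size condition is stated separately for each iteration, as the energy argument uses it; the
  uniform bounds on the parameters matter only for the rates.
\<close>

locale inertial_extragradient_run = legendre_kernel \<omega> \<mu>
  for \<omega> :: "'a::euclidean_space \<Rightarrow> ereal" and \<mu> :: real +
  fixes F H :: "'a \<Rightarrow> 'a" and X \<Omega> :: "'a set" and L_F L_H :: real
    and \<alpha> lam \<eta> :: "nat \<Rightarrow> real" and w w' y :: "nat \<Rightarrow> 'a" and x :: "int \<Rightarrow> 'a"
  assumes F_monotone: "monotone_operator_on (edom \<omega>) F"
    and F_lipschitz: "L_F-lipschitz_on (edom \<omega>) F"
    and H_monotone: "monotone_operator_on (edom \<omega>) H"
    and H_lipschitz: "L_H-lipschitz_on (edom \<omega>) H"
    and convex_X: "convex X" and convex_\<Omega>: "convex \<Omega>"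
    and X_subset: "X \<subseteq> \<Omega>" and \<Omega>_subset: "\<Omega> \<subseteq> edom \<omega>"
    and \<alpha>_nonneg: "\<alpha> k \<ge> 0" and lam_pos: "lam k > 0" and \<eta>_pos: "\<eta> k > 0"
    and step_size: "lam k * (L_F + \<eta> k * L_H) \<le> \<mu>"
    and run: "IneIREG_Bregman \<omega> X \<Omega> F H \<alpha> lam \<eta> w w' y x"
begin

abbreviation G :: "nat \<Rightarrow> 'a \<Rightarrow> 'a" where
  "G k v \<equiv> F v + \<eta> k *\<^sub>R H v"

abbreviation \<delta> :: "nat \<Rightarrow> real" where
  "\<delta> k \<equiv> \<alpha> k * (1 + \<alpha> k) / (2 * \<mu>)
     * (norm (grad \<omega> (x (int k)) - grad \<omega> (x (int k - 1))))\<^sup>2"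

lemma X_edom: "v \<in> X \<Longrightarrow> v \<in> edom \<omega>"
  using X_subset \<Omega>_subset by blast

lemma start: "x 0 \<in> X" "x 0 \<in> interior (edom \<omega>)" "x (-1) = x 0"
proof -
  have "x 0 = x (-1)" and "x 0 \<in> X \<inter> interior (edom \<omega>)"
    using run unfolding IneIREG_Bregman_def by blast+
  then show "x 0 \<in> X" "x 0 \<in> interior (edom \<omega>)" "x (-1) = x 0"
    by (blast intro: sym)+
qed

lemma w_step:
  "w k \<in> interior (edom \<omega>)"
  "grad \<omega> (w k) = (1 + \<alpha> k) *\<^sub>R grad \<omega> (x (int k)) - \<alpha> k *\<^sub>R grad \<omega> (x (int k - 1))"
proof -
  have "w k = grad (convex_conjugate \<omega>)
      ((1 + \<alpha> k) *\<^sub>R grad \<omega> (x (int k)) - \<alpha> k *\<^sub>R grad \<omega> (x (int k - 1)))"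
    using run unfolding IneIREG_Bregman_def by blast
  from mirror_point[OF this] show "w k \<in> interior (edom \<omega>)"
    "grad \<omega> (w k) = (1 + \<alpha> k) *\<^sub>R grad \<omega> (x (int k)) - \<alpha> k *\<^sub>R grad \<omega> (x (int k - 1))" .
qed

lemma G_lipschitz: "(L_F + \<eta> k * L_H)-lipschitz_on (edom \<omega>) (G k)"
  using \<eta>_pos[of k]
  by (intro lipschitz_on_add F_lipschitz lipschitz_on_cmult_nonneg H_lipschitz) auto

lemma iteration:
  shows "y k \<in> X" and "x (int k + 1) \<in> X \<inter> interior (edom \<omega>)"
    and "u \<in> X \<Longrightarrow> lam k * (G k (y k) \<bullet> (y k - u)) \<le> D\<^sub>\<omega> u (w k) - D\<^sub>\<omega> u (x (int k + 1))"
proof -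
  have 1: "is_arg_min (\<lambda>v. D\<^sub>\<omega> v (w k)) (\<lambda>v. v \<in> \<Omega>) (w' k)"
    and 2: "is_arg_min (\<lambda>v. lam k * (G k (w' k) \<bullet> v) + D\<^sub>\<omega> v (w k)) (\<lambda>v. v \<in> X) (y k)"
    and 3: "is_arg_min (\<lambda>v. lam k * (G k (y k) \<bullet> v) + D\<^sub>\<omega> v (w k)) (\<lambda>v. v \<in> X) (x (int k + 1))"
    using run unfolding IneIREG_Bregman_def by blast+
  note step = extragradient_step[OF convex_X X_subset convex_\<Omega> \<Omega>_subset start(1,2) w_step(1)
      G_lipschitz less_imp_le[OF lam_pos] step_size 1 2 3]
  show "y k \<in> X" and "x (int k + 1) \<in> X \<inter> interior (edom \<omega>)"
    and "u \<in> X \<Longrightarrow> lam k * (G k (y k) \<bullet> (y k - u)) \<le> D\<^sub>\<omega> u (w k) - D\<^sub>\<omega> u (x (int k + 1))"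
    by (fact step)+
qed

lemma iterate_in:
  assumes "i \<ge> -1"
  shows "x i \<in> X \<inter> interior (edom \<omega>)"
proof (cases "i \<ge> 1")
  case True
  then have "i = int (nat (i - 1)) + 1"
    by simp
  then show ?thesis
    using iteration(2) by metis
next
  case False
  with assms have "i = -1 \<or> i = 0"
    by auto
  then show ?thesis
    using start by auto
qed

lemma energy_descent:
  assumes u: "u \<in> X"
  shows "lam k * (G k (y k) \<bullet> (y k - u))
    \<le> (D\<^sub>\<omega> u (x (int k)) - D\<^sub>\<omega> u (x (int k + 1)))
      + \<alpha> k * (D\<^sub>\<omega> u (x (int k)) - D\<^sub>\<omega> u (x (int k - 1))) + \<delta> k"
proof -
  have "D\<^sub>\<omega> u (w k) \<le> D\<^sub>\<omega> u (x (int k))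
      + \<alpha> k * (D\<^sub>\<omega> u (x (int k)) - D\<^sub>\<omega> u (x (int k - 1))) + \<delta> k"
    using iterate_in[of "int k"] iterate_in[of "int k - 1"]
    by (intro inertial_bregman_bound \<alpha>_nonneg w_step) auto
  then show ?thesis
    using iteration(3)[OF u, of k] by simp
qed

text \<open>
  The common source of both rates; \<open>c = (\<lambda>_. 1)\<close> leads to feasibility and \<open>c = (\<lambda>j. 1 / \<eta> j)\<close>
  to optimality.
\<close>

lemma weighted_energy_sum:
  assumes u: "u \<in> X" and k: "k \<ge> 1"
    and M: "\<And>v. v \<in> X \<inter> interior (edom \<omega>) \<Longrightarrow> D\<^sub>\<omega> u v \<le> M"
    and c: "0 \<le> c 0" "\<And>j. c j \<le> c (Suc j)"
    and ca: "\<And>j. c (Suc j) * \<alpha> (Suc j) \<le> c j * \<alpha> j" "\<alpha> 0 \<le> 1"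
  shows "(\<Sum>j<k. c j * (lam j * (G j (y j) \<bullet> (y j - u))))
    \<le> c (k - 1) * M + (\<Sum>j<k. c j * \<delta> j)"
proof -
  let ?\<phi> = "\<lambda>i. D\<^sub>\<omega> u (x i)"
  have c_pos: "0 \<le> c j" for j
    using lift_Suc_mono_le[of c 0 j] c by (meson le0 order_trans)
  have "c j * (lam j * (G j (y j) \<bullet> (y j - u)))
      \<le> (c j * (?\<phi> (int j) - ?\<phi> (int j + 1)) + (c j * \<alpha> j) * (?\<phi> (int j) - ?\<phi> (int j - 1)))
        + c j * \<delta> j" for j
    using mult_left_mono[OF energy_descent[OF u, of j] c_pos[of j]]
    by (simp only: distrib_left mult.assoc)
  then have "(\<Sum>j<k. c j * (lam j * (G j (y j) \<bullet> (y j - u))))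
      \<le> (\<Sum>j<k. (c j * (?\<phi> (int j) - ?\<phi> (int j + 1)) + (c j * \<alpha> j) * (?\<phi> (int j) - ?\<phi> (int j - 1)))
        + c j * \<delta> j)"
    by (rule sum_mono)
  also have "\<dots> = (\<Sum>j<k. c j * (?\<phi> (int j) - ?\<phi> (int j + 1)) + (c j * \<alpha> j) * (?\<phi> (int j) - ?\<phi> (int j - 1)))
      + (\<Sum>j<k. c j * \<delta> j)"
    by (rule sum.distrib)
  also have "(\<Sum>j<k. c j * (?\<phi> (int j) - ?\<phi> (int j + 1)) + (c j * \<alpha> j) * (?\<phi> (int j) - ?\<phi> (int j - 1)))
      \<le> c (k - 1) * M"
  proof (rule inertial_abel_bound[OF k])
    fix i :: int
    assume "0 \<le> i"
    then have "x i \<in> X \<inter> interior (edom \<omega>)"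
      by (intro iterate_in) simp
    then show "0 \<le> ?\<phi> i" "?\<phi> i \<le> M"
      using M X_edom[OF u] by (auto intro: bregman_nonneg)
  next
    show "c 0 * \<alpha> 0 \<le> c 0"
      using mult_left_mono[OF ca(2) c(1)] by simp
  next
    show "?\<phi> (-1) = ?\<phi> 0"
      by (simp only: start(3))
    show "0 \<le> c j * \<alpha> j" for j
      using c_pos \<alpha>_nonneg by (intro mult_nonneg_nonneg)
  qed (fact c(2) ca(1))+
  finally show ?thesis
    by simp
qed

text \<open>
  Monotonicity moves \<open>F\<close> from \<open>y j\<close> to \<open>u\<close>; the terms with \<open>H\<close> are treated as a perturbation of
  size proportional to \<open>\<eta> j\<close>.
\<close>

lemma feasibility_sum:
  assumes u: "u \<in> X" and k: "k \<ge> 1"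
    and M: "\<And>v. v \<in> X \<inter> interior (edom \<omega>) \<Longrightarrow> D\<^sub>\<omega> u v \<le> M"
    and \<alpha>: "\<And>j. \<alpha> (Suc j) \<le> \<alpha> j" "\<alpha> 0 \<le> 1"
    and B: "\<And>v. v \<in> X \<Longrightarrow> norm (H v) \<le> C" "\<And>v. v \<in> X \<Longrightarrow> norm (v - u) \<le> D"
    and hi: "\<And>j. lam j \<le> hi"
  shows "(\<Sum>j<k. lam j * (F u \<bullet> (y j - u))) \<le> M + (\<Sum>j<k. \<delta> j) + hi * C * D * (\<Sum>j<k. \<eta> j)"
proof -
  have C0: "0 \<le> C" and D0: "0 \<le> D"
    using B[OF u] norm_ge_zero order_trans by blast+
  have "lam j * (F u \<bullet> (y j - u)) \<le> lam j * (G j (y j) \<bullet> (y j - u)) + hi * C * D * \<eta> j" for j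
  proof -
    have "0 \<le> (F (y j) - F u) \<bullet> (y j - u)"
      using F_monotone X_edom[OF u] X_edom[OF iteration(1)[of j]]
      unfolding monotone_operator_on_def by blast
    then have "lam j * (F u \<bullet> (y j - u)) \<le> lam j * (F (y j) \<bullet> (y j - u))"
      using lam_pos[of j] by (intro mult_left_mono) (auto simp: inner_diff_left)
    moreover have "- (H (y j) \<bullet> (y j - u)) \<le> C * D"
    proof -
      have "- (H (y j) \<bullet> (y j - u)) \<le> norm (H (y j)) * norm (y j - u)"
        using Cauchy_Schwarz_ineq2[of "H (y j)" "y j - u"] by simp
      also have "\<dots> \<le> C * D"
        using B iteration(1) C0 by (intro mult_mono) auto
      finally show ?thesis .
    qed
    then have "(lam j * \<eta> j) * (- (H (y j) \<bullet> (y j - u))) \<le> (lam j * \<eta> j) * (C * D)"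
      using lam_pos[of j] \<eta>_pos[of j] by (intro mult_left_mono) auto
    moreover have "(lam j * \<eta> j) * (C * D) \<le> (hi * \<eta> j) * (C * D)"
      using hi \<eta>_pos[of j] C0 D0 by (intro mult_right_mono) auto
    ultimately show ?thesis
      by (simp add: inner_add_left algebra_simps)
  qed
  then have "(\<Sum>j<k. lam j * (F u \<bullet> (y j - u)))
      \<le> (\<Sum>j<k. lam j * (G j (y j) \<bullet> (y j - u)) + hi * C * D * \<eta> j)"
    by (rule sum_mono)
  also have "\<dots> = (\<Sum>j<k. lam j * (G j (y j) \<bullet> (y j - u))) + hi * C * D * (\<Sum>j<k. \<eta> j)"
    by (simp add: sum.distrib sum_distrib_left)
  also have "(\<Sum>j<k. lam j * (G j (y j) \<bullet> (y j - u))) \<le> M + (\<Sum>j<k. \<delta> j)"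
    using weighted_energy_sum[OF u k M, of "\<lambda>_. 1"] \<alpha> by simp
  finally show ?thesis
    by simp
qed

text \<open>
  When \<open>u\<close> solves the inner problem, the terms with \<open>F\<close> are nonnegative and can be dropped. Dividing by
  \<open>\<eta> j\<close> then isolates the terms with \<open>H\<close>.
\<close>

lemma optimality_sum:
  assumes u: "u \<in> vi_solutions F X" and k: "k \<ge> 1"
    and M: "\<And>v. v \<in> X \<inter> interior (edom \<omega>) \<Longrightarrow> D\<^sub>\<omega> u v \<le> M"
    and \<eta>: "\<And>j. \<eta> (Suc j) \<le> \<eta> j"
    and \<alpha>: "\<And>j. \<alpha> (Suc j) * inverse (\<eta> (Suc j)) \<le> \<alpha> j * inverse (\<eta> j)" "\<alpha> 0 \<le> 1"
  shows "(\<Sum>j<k. lam j * (H u \<bullet> (y j - u)))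
    \<le> M * inverse (\<eta> (k - 1)) + (\<Sum>j<k. \<delta> j * inverse (\<eta> j))"
proof -
  have uX: "u \<in> X" and sol: "\<And>v. v \<in> X \<Longrightarrow> 0 \<le> F u \<bullet> (v - u)"
    using u by (auto simp: vi_solutions_def)
  have "lam j * (H u \<bullet> (y j - u)) \<le> inverse (\<eta> j) * (lam j * (G j (y j) \<bullet> (y j - u)))" for j
  proof -
    note dom = X_edom[OF uX] X_edom[OF iteration(1)[of j]]
    have "0 \<le> (F (y j) - F u) \<bullet> (y j - u)" "0 \<le> (H (y j) - H u) \<bullet> (y j - u)"
      using F_monotone H_monotone dom unfolding monotone_operator_on_def by blast+
    then have F: "0 \<le> F (y j) \<bullet> (y j - u)" and H: "H u \<bullet> (y j - u) \<le> H (y j) \<bullet> (y j - u)"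
      using sol[OF iteration(1)[of j]] by (auto simp: inner_diff_left)
    have "\<eta> j * (H u \<bullet> (y j - u)) \<le> G j (y j) \<bullet> (y j - u)"
      using F mult_left_mono[OF H less_imp_le[OF \<eta>_pos[of j]]] by (simp add: inner_add_left)
    then have "inverse (\<eta> j) * lam j * (\<eta> j * (H u \<bullet> (y j - u)))
        \<le> inverse (\<eta> j) * lam j * (G j (y j) \<bullet> (y j - u))"
      using \<eta>_pos[of j] lam_pos[of j] by (intro mult_left_mono) auto
    then show ?thesis
      using \<eta>_pos[of j] by (simp add: field_simps)
  qed
  then have "(\<Sum>j<k. lam j * (H u \<bullet> (y j - u)))
      \<le> (\<Sum>j<k. inverse (\<eta> j) * (lam j * (G j (y j) \<bullet> (y j - u))))"
    by (rule sum_mono)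
  also have "\<dots> \<le> inverse (\<eta> (k - 1)) * M + (\<Sum>j<k. inverse (\<eta> j) * \<delta> j)"
  proof (rule weighted_energy_sum[OF uX k M])
    show "0 \<le> inverse (\<eta> 0)"
      using \<eta>_pos[of 0] by simp
    show "inverse (\<eta> j) \<le> inverse (\<eta> (Suc j))" for j
      using \<eta>[of j] \<eta>_pos[of "Suc j"] by (rule le_imp_inverse_le)
    show "inverse (\<eta> (Suc j)) * \<alpha> (Suc j) \<le> inverse (\<eta> j) * \<alpha> j" for j
      using \<alpha>(1)[of j] by (simp only: mult.commute)
  qed (use \<alpha>(2) in blast)+
  finally show ?thesis
    by (simp add: mult.commute)
qed

end

section \<open>Convergence rates\<close>

theorem corollary9:
  fixes \<omega> :: "real ^ 'n \<Rightarrow> ereal"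
    and F H :: "real ^ 'n \<Rightarrow> real ^ 'n"
    and domF domH X \<Omega> Q :: "(real ^ 'n) set"
    and \<mu> L_F L_H L\<^sub>0 C_H B_H D_X OmX2 :: real
    and \<alpha> lam \<eta> \<delta> :: "nat \<Rightarrow> real"
    and w w' y ybar :: "nat \<Rightarrow> real ^ 'n"
    and x :: "int \<Rightarrow> real ^ 'n"
    and b lam_lo lam_hi s :: real
  assumes "\<mu> > 0" and "strongly_convex_fun \<mu> \<omega>" and "legendre_type \<omega>"
    and "monotone_operator_on domF F" and "L_F > 0" and "L_F-lipschitz_on domF F"
    and "monotone_operator_on domH H" and "L_H > 0" and "L_H-lipschitz_on domH H"
    and "X \<noteq> {}" and "closed X" and "convex X"
    and "\<Omega> \<noteq> {}" and "closed \<Omega>" and "convex \<Omega>"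
    and "X \<subseteq> \<Omega>" and "\<Omega> \<subseteq> edom \<omega>" and "edom \<omega> \<subseteq> domF \<inter> domH"
    and "Q = vi_solutions F X" and "Q \<noteq> {}"
    and "bdd_above ((\<lambda>u. norm (H u)) ` X)" and "C_H = (SUP u\<in>X. norm (H u))"
    and "bdd_above ((\<lambda>u. norm (H u)) ` Q)" and "B_H = (SUP u\<in>Q. norm (H u))"
    and "bounded X" and "D_X = diameter X"
    and "bdd_above ((\<lambda>(u, v). bregman \<omega> u v) ` (X \<times> (X \<inter> interior (edom \<omega>))))"
    and "OmX2 = (SUP (u, v) \<in> X \<times> (X \<inter> interior (edom \<omega>)). bregman \<omega> u v)"
    and "\<And>k. \<alpha> k \<ge> 0" and "\<And>k. lam k > 0" and "\<And>k. \<eta> k > 0"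
    and "IneIREG_Bregman \<omega> X \<Omega> F H \<alpha> lam \<eta> w w' y x"
    and "\<And>k. \<delta> k = \<alpha> k * (1 + \<alpha> k) / (2 * \<mu>)
                    * (norm (grad \<omega> (x (int k)) - grad \<omega> (x (int k - 1))))\<^sup>2"
    and "\<And>k. \<eta> k = \<eta> 0 / real (k + 1) powr b"
    and "0 < \<eta> 0" and "\<eta> 0 \<le> 1" and "0 < b" and "b < 1"
    and "\<alpha> 0 \<in> {0..1}" and "\<And>k. \<alpha> k * inverse (\<eta> k) \<ge> \<alpha> (k + 1) * inverse (\<eta> (k + 1))"
    and "L\<^sub>0 = L_F + \<eta> 0 * L_H"
    and "0 < lam_lo" and "lam_lo \<le> lam_hi" and "lam_hi \<le> \<mu> / L\<^sub>0"
    and "\<And>k. lam k \<in> {lam_lo..lam_hi}"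
    and "summable (\<lambda>k. \<delta> k * inverse (\<eta> k))" and "s = (\<Sum>k. \<delta> k * inverse (\<eta> k))"
    and "\<And>k. k \<ge> 1 \<Longrightarrow> ybar k = (1 / (\<Sum>j<k. lam j)) *\<^sub>R (\<Sum>j<k. lam j *\<^sub>R y j)"
  shows "(\<forall>k\<ge>1. 0 \<le> dual_gap (ybar k) F X \<and>
            dual_gap (ybar k) F X \<le> ereal (
              1 / real k * (OmX2 / lam_lo) + 1 / real k * (s / lam_lo)
              + 1 / real k powr b * (\<eta> 0 * lam_hi * C_H * D_X / ((1 - b) * lam_lo)))) \<and>
         (\<forall>k\<ge>1. ereal (- B_H * infdist (ybar k) Q) \<le> dual_gap (ybar k) H Q \<and>
            dual_gap (ybar k) H Q \<le> ereal (
              1 / real k powr (1 - b) * (OmX2 / (2 powr (- b) * lam_lo * \<eta> 0))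
              + 1 / real k * (s / lam_lo))) \<and>
         (\<forall>\<sigma> M. weakly_sharp F X \<sigma> M \<longrightarrow>
            (\<forall>k\<ge>1. dual_gap (ybar k) H Q \<ge> ereal (
              - (B_H / \<sigma> powr (1 / M)) *
                (1 / real k * (OmX2 / lam_lo) + 1 / real k * (s / lam_lo)
                 + 1 / real k powr b * (\<eta> 0 * lam_hi * C_H * D_X / ((1 - b) * lam_lo)))
                powr (1 / M))))"
proof -
  note mu = assms(1) and sc = assms(2) and leg = assms(3)
  note convex_X = assms(12) and \<Omega>_convex = assms(15) and X\<Omega> = assms(16) and \<Omega>_edom = assms(17)
    and Q = assms(19,20) and \<alpha>_pos = assms(29) and lam_pos = assms(30) and \<eta>_pos = assms(31)
    and \<eta> = assms(34) and \<eta>0 = assms(35,36) and b = assms(37,38) and lo = assms(42)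
    and sum\<delta> = assms(46,47) and ybar = assms(48)
  have lams: "lam_lo \<le> lam k" "lam k \<le> lam_hi" for k
    using assms(45)[of k] by auto
  have \<alpha>0: "\<alpha> 0 \<le> 1"
    using assms(39) by simp
  have \<alpha>\<eta>: "\<alpha> (Suc k) * inverse (\<eta> (Suc k)) \<le> \<alpha> k * inverse (\<eta> k)" for k
    using assms(40)[of k] by (simp only: Suc_eq_plus1)
  have \<eta>_mono: "\<eta> (Suc k) \<le> \<eta> k" for k
    unfolding \<eta>[of "Suc k"] \<eta>[of k] using \<eta>0 b
    by (intro divide_left_mono powr_mono2) auto
  have \<eta>_le: "\<eta> k \<le> \<eta> 0" for k
    using lift_Suc_antimono_le[of \<eta> 0 k] \<eta>_mono by simp
  \<comment> \<open>Since \<open>\<eta>\<close> decreases, a nonincreasing ratio \<open>\<alpha> / \<eta>\<close> makes \<open>\<alpha>\<close> nonincreasing.\<close>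
  have \<alpha>_mono: "\<alpha> (Suc k) \<le> \<alpha> k" for k
  proof -
    have "\<alpha> (Suc k) * inverse (\<eta> k) \<le> \<alpha> (Suc k) * inverse (\<eta> (Suc k))"
      using \<alpha>_pos \<eta>_pos \<eta>_mono by (intro mult_left_mono le_imp_inverse_le) auto
    also note \<alpha>\<eta>
    finally show ?thesis
      using \<eta>_pos[of k] by simp
  qed
  have step: "lam k * (L_F + \<eta> k * L_H) \<le> \<mu>" for k
  proof -
    have L0: "0 < L\<^sub>0"
      unfolding assms(41) using assms(5,8) \<eta>0 by (intro add_pos_pos mult_pos_pos)
    have "lam k * (L_F + \<eta> k * L_H) \<le> lam_hi * L\<^sub>0"
      unfolding assms(41) using lams lam_pos[of k] \<eta>_le[of k] \<eta>_pos[of k] assms(5,8)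
      by (intro mult_mono add_left_mono mult_right_mono) (auto intro: less_imp_le less_le_trans)
    also have "\<dots> \<le> \<mu>"
      using assms(44) L0 by (simp add: field_simps)
    finally show ?thesis .
  qed
  interpret run: inertial_extragradient_run \<omega> \<mu> F H X \<Omega> L_F L_H \<alpha> lam \<eta> w w' y x
  proof unfold_locales
    show "monotone_operator_on (edom \<omega>) F" "monotone_operator_on (edom \<omega>) H"
      using assms(4,7,18) unfolding monotone_operator_on_def by blast+
    show "L_F-lipschitz_on (edom \<omega>) F" "L_H-lipschitz_on (edom \<omega>) H"
      using assms(6,9,18) by (auto intro: lipschitz_on_subset)
  qed (fact mu sc leg convex_X \<Omega>_convex X\<Omega> \<Omega>_edom \<alpha>_pos lam_pos \<eta>_pos step assms(32))+
  have \<delta>: "\<alpha> k * (1 + \<alpha> k) / (2 * \<mu>)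
      * (norm (grad \<omega> (x (int k)) - grad \<omega> (x (int k - 1))))\<^sup>2 = \<delta> k" for k
    using assms(33) by simp
  have \<delta>_pos: "0 \<le> \<delta> k" for k
    unfolding \<delta>[symmetric] using mu \<alpha>_pos[of k] by simp
  have OmX: "bregman \<omega> u v \<le> OmX2" if "u \<in> X" "v \<in> X \<inter> interior (edom \<omega>)" for u v
    unfolding assms(28) using that
    by (intro cSUP_upper2[OF assms(27), of "(u, v)"]) auto
  have x0: "x 0 \<in> X \<inter> interior (edom \<omega>)"
    using run.start by blast
  have OmX2: "0 \<le> OmX2"
    using OmX[of "x 0" "x 0"] x0 by (simp add: bregman_def)
  have C_H: "norm (H v) \<le> C_H" if "v \<in> X" for v
    unfolding assms(22) using that assms(21) by (intro cSUP_upper)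
  have B_H: "norm (H v) \<le> B_H" if "v \<in> Q" for v
    unfolding assms(24) using that assms(23) by (intro cSUP_upper)
  have D_X: "norm (v - u) \<le> D_X" if "v \<in> X" "u \<in> X" for u v
    using diameter_bounded_bound[OF assms(25) that] assms(26) by (simp add: dist_norm)
  have C0: "0 \<le> C_H" and D0: "0 \<le> D_X"
    using C_H D_X x0 norm_ge_zero order_trans by blast+
  have hi: "0 \<le> lam_hi"
    using lo assms(43) by simp
  have s_sum: "(\<Sum>j<k. \<delta> j * inverse (\<eta> j)) \<le> s" for k
    unfolding sum\<delta>(2)
    by (intro sum_le_suminf sum\<delta>(1) finite_lessThan mult_nonneg_nonneg \<delta>_pos)
      (simp add: less_imp_le[OF \<eta>_pos])
  have s0: "0 \<le> s"
    using s_sum[of 0] by simp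
  have \<delta>_sum: "(\<Sum>j<k. \<delta> j) \<le> s" for k
  proof -
    have "\<delta> j \<le> \<delta> j * inverse (\<eta> j)" for j
      using mult_left_mono[OF one_le_inverse[OF \<eta>_pos[of j] order_trans[OF \<eta>_le \<eta>0(2)]] \<delta>_pos[of j]]
      by simp
    then show ?thesis
      using sum_mono[of "{..<k}" \<delta> "\<lambda>j. \<delta> j * inverse (\<eta> j)"] s_sum[of k] by fastforce
  qed
  have \<eta>_sum: "(\<Sum>j<k. \<eta> j) \<le> \<eta> 0 * (real k powr (1 - b) / (1 - b))" for k
  proof -
    have "(\<Sum>j<k. \<eta> j) = \<eta> 0 * (\<Sum>j<k. 1 / real (j + 1) powr b)"
      unfolding sum_distrib_left by (intro sum.cong refl) (subst \<eta>, simp)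
    also have "\<dots> \<le> \<eta> 0 * (real k powr (1 - b) / (1 - b))"
      using \<eta>0 by (intro mult_left_mono powr_sum_bound[OF b]) auto
    finally show ?thesis .
  qed
  define N where "N k = 1 / real k * (OmX2 / lam_lo) + 1 / real k * (s / lam_lo)
      + 1 / real k powr b * (\<eta> 0 * lam_hi * C_H * D_X / ((1 - b) * lam_lo))" for k
  have powr_div: "real k powr (1 - b) / real k = 1 / real k powr b" if "k \<ge> 1" for k
    using that by (simp add: powr_diff)
  have ybar_X: "ybar k \<in> X" if k: "k \<ge> 1" for k
  proof -
    have pos: "0 < (\<Sum>j<k. lam j)"
      using k lam_pos by (intro sum_pos) (auto simp: lessThan_empty_iff)
    have "(\<Sum>j<k. (lam j / (\<Sum>j<k. lam j)) *\<^sub>R y j) \<in> X"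
      using pos lam_pos run.iteration(1)
      by (intro convex_sum convex_X) (auto simp: sum_divide_distrib[symmetric] intro: less_imp_le)
    then show ?thesis
      using ybar[OF k] by (simp add: scaleR_sum_right)
  qed
  have feas: "dual_gap (ybar k) F X \<le> ereal (N k)" if k: "k \<ge> 1" for k
    unfolding dual_gap_def
  proof (rule SUP_least)
    fix u assume u: "u \<in> X"
    let ?E = "\<eta> 0 * (real k powr (1 - b) / (1 - b))"
    let ?N = "OmX2 + s + lam_hi * C_H * D_X * ?E"
    have "(\<Sum>j<k. lam j * (F u \<bullet> (y j - u))) \<le> OmX2 + (\<Sum>j<k. \<delta> j) + lam_hi * C_H * D_X * (\<Sum>j<k. \<eta> j)"
      using run.feasibility_sum[OF u k OmX[OF u] \<alpha>_mono \<alpha>0 C_H D_X[OF _ u] lams(2)]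
      by (simp only: \<delta>)
    also have "\<dots> \<le> ?N"
      using hi C0 D0 by (intro add_mono order_refl \<delta>_sum mult_left_mono \<eta>_sum) auto
    finally have sum: "(\<Sum>j<k. lam j * (F u \<bullet> (y j - u))) \<le> ?N" .
    have "0 \<le> ?E"
      using \<eta>0(1) b by simp
    from mult_nonneg_nonneg[OF mult_nonneg_nonneg[OF mult_nonneg_nonneg[OF hi C0] D0] this]
    have "0 \<le> ?N"
      using OmX2 s0 by linarith
    from weighted_average_bound[OF k lo lams(1) this sum]
    have "F u \<bullet> (ybar k - u) \<le> ?N / (real k * lam_lo)"
      unfolding ybar[OF k] .
    also have "\<dots> = OmX2 / (real k * lam_lo) + s / (real k * lam_lo)
        + (real k powr (1 - b) / real k) * (\<eta> 0 * lam_hi * C_H * D_X / ((1 - b) * lam_lo))"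
      by (simp add: add_divide_distrib mult.commute mult.left_commute)
    also have "\<dots> = N k"
      unfolding powr_div[OF k] N_def by simp
    finally show "ereal (F u \<bullet> (ybar k - u)) \<le> ereal (N k)"
      by simp
  qed
  have feas0: "0 \<le> dual_gap (ybar k) F X" if k: "k \<ge> 1" for k
    using SUP_upper[OF ybar_X[OF k], of "\<lambda>u. ereal (F u \<bullet> (ybar k - u))"]
    by (simp add: dual_gap_def zero_ereal_def)
  have opt: "dual_gap (ybar k) H Q \<le> ereal (
      1 / real k powr (1 - b) * (OmX2 / (2 powr (- b) * lam_lo * \<eta> 0)) + 1 / real k * (s / lam_lo))"
    if k: "k \<ge> 1" for k
    unfolding dual_gap_def
  proof (rule SUP_least)
    fix u assume "u \<in> Q"
    then have u: "u \<in> vi_solutions F X" and uX: "u \<in> X"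
      by (auto simp: Q vi_solutions_def)
    let ?N = "OmX2 * (real k powr b / \<eta> 0) + s"
    have inv: "inverse (\<eta> (k - 1)) = real k powr b / \<eta> 0"
      using k by (subst \<eta>) simp
    have "(\<Sum>j<k. lam j * (H u \<bullet> (y j - u))) \<le> OmX2 * inverse (\<eta> (k - 1)) + (\<Sum>j<k. \<delta> j * inverse (\<eta> j))"
      using run.optimality_sum[OF u k OmX[OF uX] \<eta>_mono \<alpha>\<eta> \<alpha>0] by (simp only: \<delta>)
    also have "\<dots> \<le> ?N"
      unfolding inv by (intro add_left_mono s_sum)
    finally have sum: "(\<Sum>j<k. lam j * (H u \<bullet> (y j - u))) \<le> ?N" .
    have "0 \<le> real k powr b / \<eta> 0"
      using \<eta>0(1) by simp
    from mult_nonneg_nonneg[OF OmX2 this] have "0 \<le> ?N"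
      using s0 by linarith
    from weighted_average_bound[OF k lo lams(1) this sum]
    have "H u \<bullet> (ybar k - u) \<le> ?N / (real k * lam_lo)"
      unfolding ybar[OF k] .
    also have "\<dots> = (real k powr b / real k) * (OmX2 / (1 * lam_lo * \<eta> 0)) + 1 / real k * (s / lam_lo)"
      by (simp add: add_divide_distrib mult.commute mult.left_commute)
    also have "real k powr b / real k = 1 / real k powr (1 - b)"
      using k by (simp add: powr_diff)
    \<comment> \<open>The sum gives the constant 1 in place of \<open>2 powr (- b)\<close>, which is at most 1.\<close>
    also have "OmX2 / (1 * lam_lo * \<eta> 0) \<le> OmX2 / (2 powr (- b) * lam_lo * \<eta> 0)"
    proof -
      have "2 powr (- b) \<le> (1::real)"
        using b powr_mono[of "- b" 0 2] by simp
      then have "2 powr (- b) * lam_lo * \<eta> 0 \<le> 1 * lam_lo * \<eta> 0"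
        by (intro mult_right_mono less_imp_le[OF lo] less_imp_le[OF \<eta>0(1)])
      moreover have "0 < 2 powr (- b) * lam_lo * \<eta> 0"
        using lo \<eta>0(1) by simp
      ultimately show ?thesis
        using OmX2 by (intro divide_left_mono mult_pos_pos) (auto simp: lo \<eta>0(1))
    qed
    finally show "ereal (H u \<bullet> (ybar k - u)) \<le> ereal (
        1 / real k powr (1 - b) * (OmX2 / (2 powr (- b) * lam_lo * \<eta> 0)) + 1 / real k * (s / lam_lo))"
      by (simp add: mult_left_mono divide_right_mono)
  qed
  have opt_lower: "ereal (- B_H * infdist (ybar k) Q) \<le> dual_gap (ybar k) H Q" for k
    using Q(2) B_H by (rule dual_gap_ge_infdist)
  have B0: "0 \<le> B_H"
    using Q(2) B_H norm_ge_zero order_trans by blast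
  have sharp: "dual_gap (ybar k) H Q \<ge> ereal (- (B_H / \<sigma> powr (1 / M)) * N k powr (1 / M))"
    if "weakly_sharp F X \<sigma> M" and k: "k \<ge> 1" for \<sigma> M k
  proof -
    have "infdist (ybar k) Q \<le> N k powr (1 / M) / \<sigma> powr (1 / M)"
      using weakly_sharp_infdist_bound[OF that(1) Q(2)[unfolded Q(1)] ybar_X[OF k] feas[OF k]]
      unfolding Q(1) .
    from mult_left_mono[OF this B0]
    have "ereal (- (B_H / \<sigma> powr (1 / M)) * N k powr (1 / M)) \<le> ereal (- B_H * infdist (ybar k) Q)"
      by simp
    also note opt_lower
    finally show ?thesis .
  qed
  show ?thesis
    using feas0 feas[unfolded N_def] opt_lower opt sharp[unfolded N_def]
    by (intro conjI allI impI)
qed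

end
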